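(* Consider the multi-agent system composed of the followers $$\dot x_i=A_ix_i+B_iu_i+E_id_i,\qquad y_i=C_ix_i+D_iu_i,\qquad \dot d_i=S_id_i,\qquad i=1,\dots,N,$$ and the leader $\dot r=S_0r$, $y_0=F_0r$, with switching communication graph $\mathcal G_{\sigma(t)}$, as described in the context. Assume: (1) every graph $\mathcal G_p$, $p\in\mathcal P$, is connected; (2) for each $i=1,\dots,N$ there exist constant matrices $X_{i1},X_{i2},U_{i1},U_{i2}$ with $$X_{i1}S_i=A_iX_{i1}+B_iU_{i1}+E_i,\quad 0=C_iX_{i1}+D_iU_{i1},$$ $$X_{i2}S_0=A_iX_{i2}+B_iU_{i2},\quad 0=C_iX_{i2}+D_iU_{i2}-F_0;$$ (3) for each $i=1,\dots,N$ the pair $\left([C_i,\ \mathbf 0^{l\times q_i}],\begin{bmatrix}A_i&E_i\\ \mathbf 0^{q_i\times n_i}&S_i\end{bmatrix}\right)$ is detectable. Let $L_0=-\mu^*P^{-1}F_0^T$ with $P$ and $\mu^*$ as specified in the context. Then there exist constant matrices $K_{ij}$ and $L_i$, $i=1,\dots,N$, $j=1,2,3$, such that the leader-following coordination problem is solved by the control law $$\begin{aligned}\dot\zeta_i&=(S_i+L_iE_i)\zeta_i+(L_iA_i-S_iL_i-L_iE_iL_i)x_i+L_iB_iu_i,\\ \dot\eta_i&=S_0\eta_i+L_0F_0\eta_{vi},\\ u_i&=K_{i1}x_i+K_{i2}(\zeta_i-L_ix_i)+K_{i3}\eta_i,\qquad i=1,\dots,N,\end{aligned}$$ where $\eta_{vi}=\sum_{j=0}^Na_{ij}(t)(\eta_i-\eta_j)$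 and $\eta_0=r$; that is, for all initial conditions of the closed-loop system, $\lim_{t\to+\infty}(y_i(t)-y_0(t))=0$ for $i=1,\dots,N$.
   Context: Agents. There are $N$ followers and one leader (agent $0$). For $i=1,\dots,N$: $x_i\in\mathbb R^{n_i}$ is the state, $y_i\in\mathbb R^l$ the output, $u_i\in\mathbb R^{m_i}$ the input, $d_i\in\mathbb R^{q_i}$ the local disturbance; $r\in\mathbb R^{n_0}$ and $y_0\in\mathbb R^l$ are the leader's state and output. All of $A_i,B_i,C_i,D_i,E_i,S_i,S_0,F_0$ are constant real matrices of compatible sizes. Standing assumptions: $(F_0,S_0)$ is detectable (output matrix listed first); $S_0,\dots,S_N$ have no eigenvalues in the open left half plane; $(A_i,B_i)$ is stabilizable for each $i=1,\dots,N$. Graphs. There are finitely many weighted digraphs $\mathcal G_1,\dots,\mathcal G_\kappa$ on the node set $\{0,1,\dots,N\}$; let $\mathcal P=\{1,\dots,\kappa\}$. Each has constant weights $a_{ij}\ge 0$, $a_{ii}=0$, with $a_{ij}>0$ if and only if there is an edge from $j$ to $i$ (agent $i$ receives information from agent $j$), and $a_{0i}=0$ for $i=1,\dots,N$. A graph is called connected if there is a directed path from node $0$ to every node $1,\dots,N$ and the subgraph induced on $\{1,\dots,N\}$ is undirected ($a_{ij}=a_{ji}$ for $i,j=1,\dots,N$). The Laplacian $L=[l_{ij}]$ is $l_{ii}=\sum_{j\ne i}a_{ij}$, $l_{ij}=-a_{ij}$ for $j\neq i$; $H_p\in\mathbb R^{N\times N}$ is the Laplacian of $\mathcal G_p$ with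 the row and column of node $0$ deleted. It is positive definite when $\mathcal G_p$ is connected. Switching. $\sigma:[0,\infty)\to\mathcal P$ is piecewise constant, with switching instants $t_0=0<t_1<t_2<\cdots$ (an infinite sequence of bounded contiguous intervals $[t_k,t_{k+1})$ on each of which $\sigma$ is constant), and $t_{k+1}-t_k\ge\tau_0>0$ for all $k$. $a_{ij}(t)$ denotes the weight $a_{ij}$ of $\mathcal G_{\sigma(t)}$. Choice of $L_0$. $P$ is a symmetric positive definite matrix with $PS_0+S_0^TP-2F_0^TF_0<0$ (it exists by detectability of $(F_0,S_0)$), $\bar\lambda>0$ is the minimum of the eigenvalues of all $H_p$, $p\in\mathcal P$, and $\mu^*=\max\{1/\bar\lambda,1\}$. The leader-following coordination problem: find a distributed control law such that for all initial conditions of the closed-loop system, $e_i(t)=y_i(t)-y_0(t)\to 0$ as $t\to+\infty$ for $i=1,\dots,N$. *)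

theory Defs
  imports
    Complex_Main
    "Jordan_Normal_Form.Char_Poly"
    "Jordan_Normal_Form.Gauss_Jordan_Elimination"
begin

definition hurwitz :: "real mat \<Rightarrow> bool" where
  "hurwitz A \<longleftrightarrow> (\<forall>z. eigenvalue (map_mat complex_of_real A) z \<longrightarrow> Re z < 0)"

definition no_open_left_half_plane_eigenvalue :: "real mat \<Rightarrow> bool" where
  "no_open_left_half_plane_eigenvalue A \<longleftrightarrow>
     (\<forall>z. eigenvalue (map_mat complex_of_real A) z \<longrightarrow> \<not> Re z < 0)"

definition stabilizable :: "real mat \<Rightarrow> real mat \<Rightarrow> bool" where
  "stabilizable A B \<longleftrightarrow>
     (\<exists>K \<in> carrier_mat (dim_col B) (dim_row A). hurwitz (A + B * K))"

text \<open>The output matrix is the first argument.\<close>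

definition detectable :: "real mat \<Rightarrow> real mat \<Rightarrow> bool" where
  "detectable C A \<longleftrightarrow>
     (\<exists>L \<in> carrier_mat (dim_row A) (dim_row C). hurwitz (A + L * C))"

definition pos_def_mat :: "nat \<Rightarrow> real mat \<Rightarrow> bool" where
  "pos_def_mat n M \<longleftrightarrow> M \<in> carrier_mat n n \<and> transpose_mat M = M \<and>
     (\<forall>v \<in> carrier_vec n. v \<noteq> 0\<^sub>v n \<longrightarrow> v \<bullet> (M *\<^sub>v v) > 0)"

definition neg_def_mat :: "nat \<Rightarrow> real mat \<Rightarrow> bool" where
  "neg_def_mat n M \<longleftrightarrow> M \<in> carrier_mat n n \<and> transpose_mat M = M \<and>
     (\<forall>v \<in> carrier_vec n. v \<noteq> 0\<^sub>v n \<longrightarrow> v \<bullet> (M *\<^sub>v v) < 0)"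

text \<open>A block row \<open>[A, B]\<close>, as a block matrix whose lower blocks have no rows.\<close>

definition block_row :: "real mat \<Rightarrow> real mat \<Rightarrow> real mat" where
  "block_row A B = four_block_mat A B (0\<^sub>m 0 (dim_col A)) (0\<^sub>m 0 (dim_col B))"

text \<open>
  A weighted digraph on the nodes \<open>0..N\<close> is given by its weights: \<open>a i j > 0\<close> means
  that there is an edge from \<open>j\<close> to \<open>i\<close>. Node \<open>0\<close> has no incoming edges.
\<close>

definition leader_digraph :: "nat \<Rightarrow> (nat \<Rightarrow> nat \<Rightarrow> real) \<Rightarrow> bool" where
  "leader_digraph N a \<longleftrightarrow>
     (\<forall>i\<in>{0..N}. \<forall>j\<in>{0..N}. a i j \<ge> 0) \<and>
     (\<forall>i\<in>{0..N}. a i i = 0) \<and>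
     (\<forall>i\<in>{1..N}. a 0 i = 0)"

definition edges :: "nat \<Rightarrow> (nat \<Rightarrow> nat \<Rightarrow> real) \<Rightarrow> (nat \<times> nat) set" where
  "edges N a = {(j, i). j \<in> {0..N} \<and> i \<in> {0..N} \<and> a i j > 0}"

definition leader_connected :: "nat \<Rightarrow> (nat \<Rightarrow> nat \<Rightarrow> real) \<Rightarrow> bool" where
  "leader_connected N a \<longleftrightarrow>
     (\<forall>i\<in>{1..N}. (0, i) \<in> (edges N a)\<^sup>*) \<and>
     (\<forall>i\<in>{1..N}. \<forall>j\<in>{1..N}. a i j = a j i)"

definition laplacian :: "nat \<Rightarrow> (nat \<Rightarrow> nat \<Rightarrow> real) \<Rightarrow> real mat" where
  "laplacian N a = mat (N + 1) (N + 1)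
     (\<lambda>(i, j). if i = j then (\<Sum>k\<in>{0..N} - {i}. a i k) else - a i j)"

definition H_mat :: "nat \<Rightarrow> (nat \<Rightarrow> nat \<Rightarrow> real) \<Rightarrow> real mat" where
  "H_mat N a = mat_delete (laplacian N a) 0 0"

text \<open>
  Below, \<open>a p\<close> is the weight function of the \<open>p\<close>-th graph, \<open>p = 1..\<kappa>\<close>. For connected
  graphs every \<open>H_mat N (a p)\<close> is symmetric, so taking its real eigenvalues loses nothing.
\<close>

definition lambda_bar :: "nat \<Rightarrow> nat \<Rightarrow> (nat \<Rightarrow> nat \<Rightarrow> nat \<Rightarrow> real) \<Rightarrow> real" where
  "lambda_bar N \<kappa> a = Min {ev. \<exists>p\<in>{1..\<kappa>}. eigenvalue (H_mat N (a p)) ev}"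

definition mu_star :: "nat \<Rightarrow> nat \<Rightarrow> (nat \<Rightarrow> nat \<Rightarrow> nat \<Rightarrow> real) \<Rightarrow> real" where
  "mu_star N \<kappa> a = max (1 / lambda_bar N \<kappa> a) 1"

definition switching_signal ::
    "nat \<Rightarrow> real \<Rightarrow> (nat \<Rightarrow> real) \<Rightarrow> (real \<Rightarrow> nat) \<Rightarrow> bool" where
  "switching_signal \<kappa> \<tau>\<^sub>0 ts \<sigma> \<longleftrightarrow>
     \<tau>\<^sub>0 > 0 \<and> ts 0 = 0 \<and> (\<forall>k. ts (Suc k) - ts k \<ge> \<tau>\<^sub>0) \<and>
     (\<forall>t\<ge>0. \<sigma> t \<in> {1..\<kappa>}) \<and>
     (\<forall>k. \<forall>t\<in>{ts k..<ts (Suc k)}. \<sigma> t = \<sigma> (ts k))"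

text \<open>
  \<open>f\<close> solves \<open>f' = g\<close> on \<open>[0, \<infinity>)\<close>, where \<open>g\<close> may jump at the instants \<open>ts k\<close>: \<open>f\<close> is
  continuous, and on every \<open>[ts k, ts (k + 1))\<close> its derivative (one-sided at the left end
  point) is \<open>g\<close>. The type of vectors carries no topology, hence the components.
\<close>

definition solves_ode ::
    "(nat \<Rightarrow> real) \<Rightarrow> nat \<Rightarrow> (real \<Rightarrow> real vec) \<Rightarrow> (real \<Rightarrow> real vec) \<Rightarrow> bool" where
  "solves_ode ts n f g \<longleftrightarrow>
     (\<forall>t\<ge>0. f t \<in> carrier_vec n) \<and>
     (\<forall>c<n. continuous_on {0..} (\<lambda>t. f t $ c)) \<and>
     (\<forall>k. \<forall>t\<in>{ts k..<ts (Suc k)}. \<forall>c<n.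
        ((\<lambda>s. f s $ c) has_real_derivative g t $ c) (at t within {ts k..<ts (Suc k)}))"

definition tends_to_zero :: "nat \<Rightarrow> (real \<Rightarrow> real vec) \<Rightarrow> bool" where
  "tends_to_zero n f \<longleftrightarrow> (\<forall>c<n. ((\<lambda>t. f t $ c) \<longlongrightarrow> 0) at_top)"

definition relative_sum ::
    "nat \<Rightarrow> nat \<Rightarrow> (nat \<Rightarrow> nat \<Rightarrow> real) \<Rightarrow> (nat \<Rightarrow> real vec) \<Rightarrow> nat \<Rightarrow> real vec" where
  "relative_sum n N a \<eta> i = finsum_vec TYPE(real) n (\<lambda>j. a i j \<cdot>\<^sub>v (\<eta> i - \<eta> j)) {0..N}"

end

theory Submission
  imports Defs "Jordan_Normal_Form.Schur_Decomposition"
begin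

text \<open>
  Everything is done with quadratic Lyapunov functions. Write \<open>\<delta> = \<zeta> - L x - d\<close> for the error of the
  disturbance observer and \<open>e = \<eta> - r\<close> for that of the leader observer of a follower. Then
  \<open>\<delta>' = (S + L E) \<delta>\<close>, and \<open>L\<close> is read off a Lyapunov matrix of the detectable pair in the third
  assumption. The errors \<open>e\<close> of all followers share the common Lyapunov function \<open>\<Sum> e \<bullet> P e\<close>,
  whatever the active graph is, because \<open>H_p \<ge> \<lambda>\<close> for the least eigenvalue \<open>\<lambda>\<close> and \<open>\<mu> \<lambda> \<ge> 1\<close>.
  With \<open>K2 = U1 - K1 X1\<close> and \<open>K3 = U2 - K1 X2\<close> the deviation \<open>\<xi> = x - X1 d - X2 r\<close> obeys
  \<open>\<xi>' = (A + B K1) \<xi> + B (K2 \<delta> + K3 e)\<close>, a Hurwitz system with vanishing input, and the regulator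
  equations make the tracking error a linear function of \<open>\<xi>\<close>, \<open>\<delta>\<close> and \<open>e\<close>.
\<close>

subsection \<open>Quadratic forms\<close>

text \<open>Two obstacles shape the argument. The active graph may change for ever, so decay has to
  be certified by functions that do not depend on the graph; trajectories are never solved for, only
  their energies are estimated. The coupling is known to dissipate only the total over all
  followers, hence the sum. Secondly, strict inequalities have to become uniform decay rates.
  Instead of compactness of the unit sphere, the supremum of all lower bounds of a symmetric form is
  shown to be an eigenvalue; the same fact turns \<open>lambda_bar\<close>, a minimum of
  eigenvalues, into a bound on the forms of all graphs. The factor \<open>2\<close> in the
  inequality for \<open>P\<close> comes from differentiating a quadratic form: the coupling
  contributes \<open>- 2 \<mu>\<close> times a sum that is at least \<open>\<lambda>\<close> times
  the sum of the squared lengths of \<open>F e\<close>, and \<open>\<mu> \<lambda> \<ge> 1\<close>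
  leaves the term \<open>- 2 F\<^sup>T F\<close>. The closed loop is a cascade: neither
  \<open>\<delta>\<close> nor \<open>e\<close> is driven by \<open>\<xi>\<close>. Therefore the
  gains can be chosen independently of one another, apart from the feedforward correction in
  \<open>K2\<close> and \<open>K3\<close>.\<close>

lemma scalar_prod_self_pos:
  fixes v :: "real vec"
  assumes "v \<in> carrier_vec n" "v \<noteq> 0\<^sub>v n"
  shows "v \<bullet> v > 0"
proof -
  obtain i where "i < n" "v $ i \<noteq> 0" using assms by (metis carrier_vecD eq_vecI index_zero_vec)
  then have "(\<Sum>k\<in>{0..<n}. v $ k * v $ k) > 0"
    by (intro sum_pos2[of _ i]) (auto simp: less_le)
  then show ?thesis using assms by (simp add: scalar_prod_def)
qed

lemma scalar_prod_self_nonneg: "(v :: real vec) \<bullet> v \<ge> 0"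
  by (simp add: scalar_prod_def sum_nonneg)

lemma square_index_le_scalar_prod_self:
  fixes v :: "real vec"
  assumes "i < dim_vec v"
  shows "(v $ i)\<^sup>2 \<le> v \<bullet> v"
  unfolding scalar_prod_def power2_eq_square
  using assms by (intro member_le_sum) auto

lemma scalar_prod_mult_mat_vec_eq_sum:
  fixes A :: "'a :: comm_semiring_0 mat"
  assumes "A \<in> carrier_mat n k" "v \<in> carrier_vec n" "w \<in> carrier_vec k"
  shows "v \<bullet> (A *\<^sub>v w) = (\<Sum>i\<in>{0..<n}. \<Sum>j\<in>{0..<k}. A $$ (i, j) * (v $ i * w $ j))"
proof -
  have "v \<bullet> (A *\<^sub>v w) = (\<Sum>i\<in>{0..<n}. v $ i * (\<Sum>j\<in>{0..<k}. A $$ (i, j) * w $ j))"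
    unfolding scalar_prod_def[of v] using assms
    by (intro sum.cong) (auto simp: scalar_prod_def)
  then show ?thesis by (simp add: sum_distrib_left mult_ac)
qed

lemma scalar_prod_mult_mat_vec_transpose:
  fixes A :: "'a :: comm_semiring_0 mat"
  assumes "A \<in> carrier_mat n k" "v \<in> carrier_vec n" "w \<in> carrier_vec k"
  shows "w \<bullet> (transpose_mat A *\<^sub>v v) = v \<bullet> (A *\<^sub>v w)"
proof -
  have "transpose_mat A \<in> carrier_mat k n" using assms by simp
  then show ?thesis using assms
    by (subst (1 2) scalar_prod_mult_mat_vec_eq_sum) (auto simp: mult_ac intro: sum.swap[THEN trans])
qed

lemma quadratic_form_bounded:
  fixes A :: "real mat"
  assumes A: "A \<in> carrier_mat n n"
  obtains K where "K > 0" "\<And>v. v \<in> carrier_vec n \<Longrightarrow> \<bar>v \<bullet> (A *\<^sub>v v)\<bar> \<le> K * (v \<bullet> v)"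
proof
  \<comment> \<open>The \<open>+ 1\<close> keeps \<open>K\<close> positive for the zero matrix and
    in dimension \<open>0\<close>.\<close>
  define K where "K = (\<Sum>i\<in>{0..<n}. \<Sum>j\<in>{0..<n}. \<bar>A $$ (i, j)\<bar>) + 1"
  have K0: "K \<ge> 1" unfolding K_def by (simp add: sum_nonneg)
  then show "K > 0" by simp
  fix v :: "real vec" assume v: "v \<in> carrier_vec n"
  have "\<bar>v $ i * v $ j\<bar> \<le> v \<bullet> v" if "i < n" "j < n" for i j
  proof -
    have "(v $ i)\<^sup>2 \<le> v \<bullet> v" "(v $ j)\<^sup>2 \<le> v \<bullet> v"
      using v that by (auto intro: square_index_le_scalar_prod_self)
    moreover have "2 * \<bar>v $ i * v $ j\<bar> \<le> (v $ i)\<^sup>2 + (v $ j)\<^sup>2"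
      using sum_squares_bound[of "\<bar>v $ i\<bar>" "\<bar>v $ j\<bar>"] by (simp add: abs_mult)
    ultimately show ?thesis by linarith
  qed
  then have "\<bar>v \<bullet> (A *\<^sub>v v)\<bar> \<le> (\<Sum>i\<in>{0..<n}. \<Sum>j\<in>{0..<n}. \<bar>A $$ (i, j)\<bar> * (v \<bullet> v))"
    unfolding scalar_prod_mult_mat_vec_eq_sum[OF A v v]
    by (intro order.trans[OF sum_abs] sum_mono)
      (auto simp: abs_mult[of "A $$ _"] intro!: mult_left_mono)
  also have "\<dots> = (K - 1) * (v \<bullet> v)" by (simp add: K_def sum_distrib_right)
  also have "\<dots> \<le> K * (v \<bullet> v)" using scalar_prod_self_nonneg[of v] by (simp add: algebra_simps)
  finally show "\<bar>v \<bullet> (A *\<^sub>v v)\<bar> \<le> K * (v \<bullet> v)" .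
qed

text \<open>The squared length of the image is the quadratic form of
  \<open>transpose_mat A * A\<close>.\<close>

lemma mult_mat_vec_bounded:
  fixes A :: "real mat"
  assumes A: "A \<in> carrier_mat k n"
  obtains K where "K > 0" "\<And>v. v \<in> carrier_vec n \<Longrightarrow> (A *\<^sub>v v) \<bullet> (A *\<^sub>v v) \<le> K * (v \<bullet> v)"
proof -
  have "transpose_mat A * A \<in> carrier_mat n n" using A by simp
  from quadratic_form_bounded[OF this] obtain K where K: "K > 0"
    "\<And>v. v \<in> carrier_vec n \<Longrightarrow> \<bar>v \<bullet> ((transpose_mat A * A) *\<^sub>v v)\<bar> \<le> K * (v \<bullet> v)" by blast
  moreover have "v \<bullet> ((transpose_mat A * A) *\<^sub>v v) = (A *\<^sub>v v) \<bullet> (A *\<^sub>v v)" if v: "v \<in> carrier_vec n" for v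
  proof -
    have "(transpose_mat A * A) *\<^sub>v v = transpose_mat A *\<^sub>v (A *\<^sub>v v)"
      using A v by (intro assoc_mult_mat_vec) auto
    then show ?thesis using A v by (simp add: scalar_prod_mult_mat_vec_transpose[of A k n])
  qed
  ultimately show ?thesis using that[of K] by fastforce
qed

text \<open>A trivial kernel makes the determinant nonzero. The inverse is named
  \<open>the (mat_inverse A)\<close> because \<open>L\<^sub>0\<close> is given in this form.\<close>

lemma injective_mat_inverse:
  fixes A :: "'a :: field mat"
  assumes A: "A \<in> carrier_mat n n"
    and inj: "\<And>v. v \<in> carrier_vec n \<Longrightarrow> A *\<^sub>v v = 0\<^sub>v n \<Longrightarrow> v = 0\<^sub>v n"
  shows "the (mat_inverse A) \<in> carrier_mat n n" "A * the (mat_inverse A) = 1\<^sub>m n"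
    "the (mat_inverse A) * A = 1\<^sub>m n"
proof -
  have "det A \<noteq> 0" using inj det_0_iff_vec_prod_zero_field[OF A] by blast
  then have "A \<in> Units (ring_mat TYPE('a) n ())" by (rule det_non_zero_imp_unit[OF A])
  then obtain B where "mat_inverse A = Some B" using mat_inverse(1)[OF A] by fastforce
  then show "the (mat_inverse A) \<in> carrier_mat n n" "A * the (mat_inverse A) = 1\<^sub>m n"
    "the (mat_inverse A) * A = 1\<^sub>m n"
    using mat_inverse(2)[OF A] by auto
qed

lemma pos_def_mat_inverse:
  assumes "pos_def_mat n P"
  shows "the (mat_inverse P) \<in> carrier_mat n n" "P * the (mat_inverse P) = 1\<^sub>m n"
proof -
  have P: "P \<in> carrier_mat n n" using assms by (simp add: pos_def_mat_def)
  have "v = 0\<^sub>v n" if "v \<in> carrier_vec n" "P *\<^sub>v v = 0\<^sub>v n" for v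
    using assms that unfolding pos_def_mat_def by (metis scalar_prod_right_zero less_irrefl)
  from injective_mat_inverse(1,2)[OF P this]
  show "the (mat_inverse P) \<in> carrier_mat n n" "P * the (mat_inverse P) = 1\<^sub>m n" by blast+
qed

lemma smult_mat_mult_mat_vec:
  fixes A :: "'a :: comm_ring_1 mat"
  assumes "A \<in> carrier_mat n k" "v \<in> carrier_vec k"
  shows "(c \<cdot>\<^sub>m A) *\<^sub>v v = c \<cdot>\<^sub>v (A *\<^sub>v v)"
  using assms by (intro eq_vecI) auto

lemma symmetric_scalar_prod:
  fixes G :: "real mat"
  assumes "G \<in> carrier_mat n n" "transpose_mat G = G" "v \<in> carrier_vec n" "w \<in> carrier_vec n"
  shows "w \<bullet> (G *\<^sub>v v) = v \<bullet> (G *\<^sub>v w)"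
  using scalar_prod_mult_mat_vec_transpose[of G n n v w] assms by simp

text \<open>A uniform constant without compactness: the inverse bounds \<open>v\<close> by
  \<open>G v\<close>, and semidefiniteness bounds \<open>G v\<close> by the form itself. Multiplying
  the two bounds gives \<open>1 / (k * K)\<close>.\<close>

lemma semidefinite_injective_coercive:
  fixes G :: "real mat"
  assumes G: "G \<in> carrier_mat n n" "transpose_mat G = G"
    and psd: "\<And>v. v \<in> carrier_vec n \<Longrightarrow> v \<bullet> (G *\<^sub>v v) \<ge> 0"
    and inj: "\<And>v. v \<in> carrier_vec n \<Longrightarrow> G *\<^sub>v v = 0\<^sub>v n \<Longrightarrow> v = 0\<^sub>v n"
  obtains c where "c > 0" "\<And>v. v \<in> carrier_vec n \<Longrightarrow> c * (v \<bullet> v) \<le> v \<bullet> (G *\<^sub>v v)"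
proof -
  define Q where "Q = the (mat_inverse G)"
  have Q: "Q \<in> carrier_mat n n" "Q * G = 1\<^sub>m n"
    using injective_mat_inverse[OF G(1) inj] unfolding Q_def by blast+
  obtain K where K: "K > 0" "\<And>v. v \<in> carrier_vec n \<Longrightarrow> \<bar>v \<bullet> (G *\<^sub>v v)\<bar> \<le> K * (v \<bullet> v)"
    using quadratic_form_bounded[OF G(1)] by blast
  obtain k where k: "k > 0" "\<And>v. v \<in> carrier_vec n \<Longrightarrow> (Q *\<^sub>v v) \<bullet> (Q *\<^sub>v v) \<le> k * (v \<bullet> v)"
    using mult_mat_vec_bounded[OF Q(1)] by blast
  have "1 / (k * K) * (v \<bullet> v) \<le> v \<bullet> (G *\<^sub>v v)" if v: "v \<in> carrier_vec n" for v
  proof -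
    define w where "w = G *\<^sub>v v"
    have w: "w \<in> carrier_vec n" using G v by (simp add: w_def)
    have "Q *\<^sub>v w = v" unfolding w_def using Q G v
      by (metis assoc_mult_mat_vec one_mult_mat_vec)
    then have 1: "v \<bullet> v \<le> k * (w \<bullet> w)" using k(2)[OF w] by simp
    \<comment> \<open>Nonnegativity of the form at \<open>v - K\<inverse> G v\<close> gives \<open>|G v|\<^sup>2 \<le> K (v \<bullet> G v)\<close>.\<close>
    have "0 \<le> (v - (1 / K) \<cdot>\<^sub>v w) \<bullet> (G *\<^sub>v (v - (1 / K) \<cdot>\<^sub>v w))"
      using v w by (intro psd) auto
    also have "\<dots> = v \<bullet> w - (1 / K) * (v \<bullet> (G *\<^sub>v w)) - (1 / K) * (w \<bullet> w)
        + (1 / K) * ((1 / K) * (w \<bullet> (G *\<^sub>v w)))"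
      using v w G(1)
      by (simp add: mult_minus_distrib_mat_vec[of G n n] mult_mat_vec[of G n n]
          minus_scalar_prod_distrib[of _ n] scalar_prod_minus_distrib[of _ n] flip: w_def)
        (simp add: algebra_simps diff_divide_distrib)
    also have "v \<bullet> (G *\<^sub>v w) = w \<bullet> w"
      using symmetric_scalar_prod[OF G w v] by (simp add: w_def)
    \<comment> \<open>With step length \<open>1 / K\<close> the second-order term cancels at most
      one of the two first-order terms and leaves the other.\<close>
    also have "(1 / K) * ((1 / K) * (w \<bullet> (G *\<^sub>v w))) \<le> (1 / K) * (w \<bullet> w)"
    proof -
      have "(1 / K) * (w \<bullet> (G *\<^sub>v w)) \<le> w \<bullet> w"
        using K(1) K(2)[OF w] by (simp add: field_simps)
      then show ?thesis using K(1) by (intro mult_left_mono) auto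
    qed
    finally have "w \<bullet> w \<le> K * (v \<bullet> w)" using K(1) by (simp add: field_simps)
    with 1 k(1) have "v \<bullet> v \<le> k * (K * (v \<bullet> w))"
      by (meson mult_left_mono order.trans less_imp_le)
    then show ?thesis using K(1) k(1) by (simp add: w_def field_simps)
  qed
  then show ?thesis using that[of "1 / (k * K)"] K(1) k(1) by simp
qed

text \<open>The candidate \<open>m\<close> is the largest lower bound of the Rayleigh quotient. Were
  it not an eigenvalue, \<open>H - m\<close> would be semidefinite and injective, hence coercive,
  and \<open>m\<close> could be increased.\<close>

lemma symmetric_min_eigenvalue:
  fixes H :: "real mat"
  assumes H: "H \<in> carrier_mat n n" "transpose_mat H = H" and n: "n > 0"
  obtains m where "eigenvalue H m" "\<And>v. v \<in> carrier_vec n \<Longrightarrow> m * (v \<bullet> v) \<le> v \<bullet> (H *\<^sub>v v)"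
proof -
  define Y where "Y = {b. \<forall>v\<in>carrier_vec n. b * (v \<bullet> v) \<le> v \<bullet> (H *\<^sub>v v)}"
  define m where "m = Sup Y"
  obtain K where K: "K > 0" "\<And>v. v \<in> carrier_vec n \<Longrightarrow> \<bar>v \<bullet> (H *\<^sub>v v)\<bar> \<le> K * (v \<bullet> v)"
    using quadratic_form_bounded[OF H(1)] by blast
  have "- K \<in> Y" unfolding Y_def using K(2) by (auto simp: abs_le_iff algebra_simps) (smt (verit))
  then have ne: "Y \<noteq> {}" by blast
  \<comment> \<open>One unit vector bounds \<open>Y\<close> from above; \<open>n > 0\<close>
    supplies it.\<close>
  define e :: "real vec" where "e = unit_vec n 0"
  have e: "e \<in> carrier_vec n" "e \<bullet> e = 1" using n by (auto simp: e_def)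
  have bdd: "bdd_above Y"
    by (rule bdd_aboveI[of _ "e \<bullet> (H *\<^sub>v e)"]) (use e in \<open>auto simp: Y_def\<close>)
  have m: "m * (v \<bullet> v) \<le> v \<bullet> (H *\<^sub>v v)" if v: "v \<in> carrier_vec n" for v
  proof (cases "v = 0\<^sub>v n")
    case True
    then show ?thesis using H by simp
  next
    case False
    have p: "v \<bullet> v > 0" by (rule scalar_prod_self_pos[OF v False])
    have "m \<le> v \<bullet> (H *\<^sub>v v) / (v \<bullet> v)"
      unfolding m_def using v p by (intro cSup_least[OF ne]) (auto simp: Y_def field_simps)
    then show ?thesis using p by (simp add: field_simps)
  qed
  define G where "G = H - m \<cdot>\<^sub>m 1\<^sub>m n"
  have G: "G \<in> carrier_mat n n" unfolding G_def by (intro minus_carrier_mat smult_carrier_mat one_carrier_mat)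
  have Gt: "transpose_mat G = G"
  proof (rule eq_matI)
    fix i j assume ij: "i < dim_row G" "j < dim_col G"
    then have "H $$ (i, j) = H $$ (j, i)" using H G
      by (metis carrier_matD index_transpose_mat(1))
    then show "transpose_mat G $$ (i, j) = G $$ (i, j)" using ij H G by (auto simp: G_def)
  qed (use G in auto)
  have Gv: "G *\<^sub>v v = H *\<^sub>v v - m \<cdot>\<^sub>v v" if v: "v \<in> carrier_vec n" for v
    using H(1) v by (simp add: G_def minus_mult_distrib_mat_vec[of _ n n] smult_mat_mult_mat_vec[of _ n n])
  have vGv: "v \<bullet> (G *\<^sub>v v) = v \<bullet> (H *\<^sub>v v) - m * (v \<bullet> v)" if v: "v \<in> carrier_vec n" for v
    using H(1) v by (simp add: Gv scalar_prod_minus_distrib[of _ n])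
  have "eigenvalue H m"
  proof (rule ccontr)
    assume ne: "\<not> eigenvalue H m"
    have inj: "v = 0\<^sub>v n" if v: "v \<in> carrier_vec n" and 0: "G *\<^sub>v v = 0\<^sub>v n" for v
    proof (rule ccontr)
      assume "v \<noteq> 0\<^sub>v n"
      moreover have "H *\<^sub>v v = m \<cdot>\<^sub>v v"
      proof (rule eq_vecI)
        fix i assume "i < dim_vec (m \<cdot>\<^sub>v v)"
        then have i: "i < n" using v by simp
        then have "(H *\<^sub>v v - m \<cdot>\<^sub>v v) $ i = 0" using 0 Gv[OF v] by simp
        then show "(H *\<^sub>v v) $ i = (m \<cdot>\<^sub>v v) $ i" using i v H(1) by auto
      qed (use H(1) v in auto)
      ultimately show False using ne v H(1) by (auto simp: eigenvalue_def eigenvector_def)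
    qed
    have psd: "v \<bullet> (G *\<^sub>v v) \<ge> 0" if "v \<in> carrier_vec n" for v using m vGv that by simp
    obtain c where c: "c > 0" "\<And>v. v \<in> carrier_vec n \<Longrightarrow> c * (v \<bullet> v) \<le> v \<bullet> (G *\<^sub>v v)"
      using semidefinite_injective_coercive[OF G Gt psd inj] by blast
    have "m + c \<in> Y" unfolding Y_def using c(2) vGv by (force simp: algebra_simps)
    then have "m + c \<le> m" unfolding m_def using bdd by (rule cSup_upper)
    then show False using c(1) by simp
  qed
  then show ?thesis using that m by blast
qed

text \<open>Symmetry is not assumed because a typical instance is \<open>- (P * M)\<close>. The
  symmetrization \<open>A + transpose_mat A\<close> has twice the form, and an eigenvector for its
  least eigenvalue shows that this eigenvalue is positive.\<close>

lemma positive_form_coercive: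
  fixes A :: "real mat"
  assumes A: "A \<in> carrier_mat n n"
    and pos: "\<And>v. v \<in> carrier_vec n \<Longrightarrow> v \<noteq> 0\<^sub>v n \<Longrightarrow> v \<bullet> (A *\<^sub>v v) > 0"
  obtains c where "c > 0" "\<And>v. v \<in> carrier_vec n \<Longrightarrow> c * (v \<bullet> v) \<le> v \<bullet> (A *\<^sub>v v)"
proof (cases "n = 0")
  case True
  \<comment> \<open>In dimension \<open>0\<close> there is no eigenvalue to take, but both sides
    vanish and any constant serves.\<close>
  then have "1 * (v \<bullet> v) \<le> v \<bullet> (A *\<^sub>v v)" if "v \<in> carrier_vec n" for v
    using that by (simp add: scalar_prod_def)
  then show ?thesis using that[of 1] by simp
next
  case False
  define H where "H = A + transpose_mat A"
  have H: "H \<in> carrier_mat n n" "transpose_mat H = H"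
    using A by (auto simp: H_def transpose_add[of _ n n] comm_add_mat[of _ n n])
  have vH: "v \<bullet> (H *\<^sub>v v) = 2 * (v \<bullet> (A *\<^sub>v v))" if v: "v \<in> carrier_vec n" for v
    using A v by (simp add: H_def add_mult_distrib_mat_vec[of _ n n] scalar_prod_add_distrib[of _ n]
        scalar_prod_mult_mat_vec_transpose[of _ n n])
  obtain m where m: "eigenvalue H m" "\<And>v. v \<in> carrier_vec n \<Longrightarrow> m * (v \<bullet> v) \<le> v \<bullet> (H *\<^sub>v v)"
    using symmetric_min_eigenvalue[OF H] False by blast
  obtain v where v: "v \<in> carrier_vec n" "v \<noteq> 0\<^sub>v n" "H *\<^sub>v v = m \<cdot>\<^sub>v v"
    using m(1) H(1) by (auto simp: eigenvalue_def eigenvector_def)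
  have "v \<bullet> (H *\<^sub>v v) = m * (v \<bullet> v)" using v by simp
  moreover have "v \<bullet> (H *\<^sub>v v) > 0" using pos[OF v(1,2)] vH[OF v(1)] by simp
  ultimately have "m > 0" using scalar_prod_self_pos[OF v(1,2)]
    by (metis mult_less_0_iff not_less_iff_gr_or_eq mult_zero_left zero_less_mult_pos2)
  moreover have "m / 2 * (v \<bullet> v) \<le> v \<bullet> (A *\<^sub>v v)" if "v \<in> carrier_vec n" for v
    using m(2)[OF that] vH[OF that] by simp
  ultimately show ?thesis using that[of "m / 2"] by simp
qed

subsection \<open>Lyapunov matrices\<close>

text \<open>Rescaling the coordinates by powers of a large number makes the strictly upper part
  small against the diagonal. The weights are the squares of the scaling factors, so they form a
  diagonal Lyapunov matrix for \<open>T\<close>.\<close>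

lemma upper_triangular_weighted_form_negative:
  fixes T :: "complex mat"
  assumes T: "T \<in> carrier_mat n n" "upper_triangular T"
    and neg: "\<And>i. i < n \<Longrightarrow> Re (T $$ (i, i)) < 0"
  obtains w :: "nat \<Rightarrow> real" where "\<And>i. w i > 0"
    "\<And>z. z \<in> carrier_vec n \<Longrightarrow> z \<noteq> 0\<^sub>v n \<Longrightarrow> (\<Sum>i\<in>{0..<n}. w i * Re (cnj (z $ i) * (T *\<^sub>v z) $ i)) < 0"
proof -
  obtain \<delta> where \<delta>: "\<delta> > 0" "\<And>i. i < n \<Longrightarrow> Re (T $$ (i, i)) \<le> - \<delta>"
  proof (cases "n = 0")
    case False
    define M where "M = Max ((\<lambda>i. Re (T $$ (i, i))) ` {0..<n})"
    have "M \<in> (\<lambda>i. Re (T $$ (i, i))) ` {0..<n}" unfolding M_def using False by (intro Max_in) auto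
    then have "M < 0" using neg by auto
    moreover have "Re (T $$ (i, i)) \<le> M" if "i < n" for i
      unfolding M_def using that by (intro Max_ge) auto
    ultimately show ?thesis using that[of "- M"] by simp
  qed (use that[of 1] in auto)
  define c where "c = (\<Sum>i\<in>{0..<n}. \<Sum>j\<in>{0..<n}. cmod (T $$ (i, j)))"
  have c0: "c \<ge> 0" by (simp add: c_def sum_nonneg)
  have c: "cmod (T $$ (i, j)) \<le> c" if "i < n" "j < n" for i j
  proof -
    have "cmod (T $$ (i, j)) \<le> (\<Sum>j\<in>{0..<n}. cmod (T $$ (i, j)))"
      using that by (intro member_le_sum) auto
    also have "\<dots> \<le> c" unfolding c_def using that
      by (intro member_le_sum[of i _ "\<lambda>i. \<Sum>j\<in>{0..<n}. cmod (T $$ (i, j))"]) (auto intro: sum_nonneg)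
    finally show ?thesis .
  qed
  \<comment> \<open>With weights \<open>K\<^sup>2\<^sup>i\<close> every strictly upper entry is damped by a factor \<open>1 / K\<close> at least.\<close>
  define K where "K = 1 + c * real n / \<delta>"
  have K1: "K \<ge> 1" using c0 \<delta>(1) by (simp add: K_def)
  \<comment> \<open>This is what the size of \<open>K\<close> is for: all cross terms together cost
    at most \<open>c * real n / K\<close> times the sum of squares, which must stay below the
    diagonal gap \<open>\<delta>\<close>.\<close>
  have K\<delta>: "c * real n / K < \<delta>"
    using \<delta>(1) K1 by (simp add: K_def field_simps)
  have main: "(\<Sum>i\<in>{0..<n}. (K ^ i)\<^sup>2 * Re (cnj (z $ i) * (T *\<^sub>v z) $ i)) < 0"
    if z: "z \<in> carrier_vec n" "z \<noteq> 0\<^sub>v n" for z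
  proof -
    define y where "y i = K ^ i * cmod (z $ i)" for i
    have y0: "y i \<ge> 0" for i using K1 by (simp add: y_def)
    \<comment> \<open>The cross term is granted to every pair, also on and below the diagonal, so
      that the bounds add up to a full double sum.\<close>
    have entry: "(K ^ i)\<^sup>2 * Re (cnj (z $ i) * (T $$ (i, j) * z $ j))
        \<le> (if i = j then - \<delta> * (y i)\<^sup>2 else 0) + c / K * (y i * y j)" if ij: "i < n" "j < n" for i j
    proof -
      consider "j < i" | "i = j" | "i < j" by linarith
      then show ?thesis
      proof cases
        case 1
        then have "T $$ (i, j) = 0" using T ij by auto
        moreover have "0 \<le> c / K * (y i * y j)" using c0 K1 y0 by (intro mult_nonneg_nonneg) auto
        ultimately show ?thesis using 1 by simp
      next
        case 2
        have "Re (cnj (z $ i) * (T $$ (i, i) * z $ i)) = Re (T $$ (i, i)) * (cmod (z $ i))\<^sup>2"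
          by (simp add: cmod_power2) (simp add: power2_eq_square algebra_simps)
        also have "\<dots> \<le> - \<delta> * (cmod (z $ i))\<^sup>2" using \<delta>(2)[OF ij(1)] by (intro mult_right_mono) auto
        finally have "(K ^ i)\<^sup>2 * Re (cnj (z $ i) * (T $$ (i, i) * z $ i)) \<le> (K ^ i)\<^sup>2 * (- \<delta> * (cmod (z $ i))\<^sup>2)"
          by (intro mult_left_mono) auto
        also have "\<dots> = - \<delta> * (y i)\<^sup>2" by (simp add: y_def power_mult_distrib)
        also have "\<dots> \<le> - \<delta> * (y i)\<^sup>2 + c / K * (y i * y i)" using c0 K1 y0 by simp
        finally show ?thesis using 2 by simp
      next
        case 3
        have "Re (cnj (z $ i) * (T $$ (i, j) * z $ j)) \<le> cmod (cnj (z $ i) * (T $$ (i, j) * z $ j))"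
          by (rule complex_Re_le_cmod)
        also have "\<dots> = cmod (T $$ (i, j)) * (cmod (z $ i) * cmod (z $ j))" by (simp add: norm_mult)
        also have "\<dots> \<le> c * (cmod (z $ i) * cmod (z $ j))" using c[OF ij] by (intro mult_right_mono) auto
        finally have "(K ^ i)\<^sup>2 * Re (cnj (z $ i) * (T $$ (i, j) * z $ j))
            \<le> (K ^ i)\<^sup>2 * (c * (cmod (z $ i) * cmod (z $ j)))" by (intro mult_left_mono) auto
        \<comment> \<open>One power of \<open>K\<close> is borrowed here; it is available because
          \<open>Suc i \<le> j\<close> strictly above the diagonal.\<close>
        also have "\<dots> = c / K * (K ^ i * cmod (z $ i) * (K ^ Suc i * cmod (z $ j)))"
          using K1 by (simp add: power2_eq_square)
        also have "\<dots> \<le> c / K * (K ^ i * cmod (z $ i) * (K ^ j * cmod (z $ j)))"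
          using c0 K1 3 by (intro mult_left_mono mult_right_mono power_increasing) auto
        finally show ?thesis using 3 by (simp add: y_def)
      qed
    qed
    have "(\<Sum>i\<in>{0..<n}. (K ^ i)\<^sup>2 * Re (cnj (z $ i) * (T *\<^sub>v z) $ i))
        = (\<Sum>i\<in>{0..<n}. \<Sum>j\<in>{0..<n}. (K ^ i)\<^sup>2 * Re (cnj (z $ i) * (T $$ (i, j) * z $ j)))"
    proof (intro sum.cong refl)
      fix i assume "i \<in> {0..<n}"
      then have "(T *\<^sub>v z) $ i = (\<Sum>j\<in>{0..<n}. T $$ (i, j) * z $ j)"
        using T z by (auto simp: scalar_prod_def)
      then show "(K ^ i)\<^sup>2 * Re (cnj (z $ i) * (T *\<^sub>v z) $ i)
          = (\<Sum>j\<in>{0..<n}. (K ^ i)\<^sup>2 * Re (cnj (z $ i) * (T $$ (i, j) * z $ j)))"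
        by (simp only: sum_distrib_left Re_sum)
    qed
    also have "\<dots> \<le> (\<Sum>i\<in>{0..<n}. \<Sum>j\<in>{0..<n}. (if i = j then - \<delta> * (y i)\<^sup>2 else 0) + c / K * (y i * y j))"
      by (intro sum_mono entry) auto
    also have "\<dots> = - \<delta> * (\<Sum>i\<in>{0..<n}. (y i)\<^sup>2) + c / K * (\<Sum>i\<in>{0..<n}. \<Sum>j\<in>{0..<n}. y i * y j)"
      by (simp add: sum.distrib sum_distrib_left sum_subtractf sum_negf)
    also have "\<dots> \<le> - \<delta> * (\<Sum>i\<in>{0..<n}. (y i)\<^sup>2) + c / K * (\<Sum>i\<in>{0..<n}. \<Sum>j\<in>{0..<n}. ((y i)\<^sup>2 + (y j)\<^sup>2) / 2)"
    proof -
      have "y i * y j \<le> ((y i)\<^sup>2 + (y j)\<^sup>2) / 2" for i j using sum_squares_bound[of "y i" "y j"] by simp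
      then show ?thesis using c0 K1 by (intro add_left_mono mult_left_mono sum_mono) auto
    qed
    also have "(\<Sum>i\<in>{0..<n}. \<Sum>j\<in>{0..<n}. ((y i)\<^sup>2 + (y j)\<^sup>2) / 2) = real n * (\<Sum>i\<in>{0..<n}. (y i)\<^sup>2)"
      by (simp add: sum.distrib add_divide_distrib sum_distrib_left sum_divide_distrib[symmetric])
    also have "- \<delta> * (\<Sum>i\<in>{0..<n}. (y i)\<^sup>2) + c / K * (real n * (\<Sum>i\<in>{0..<n}. (y i)\<^sup>2))
        = - (\<delta> - c * real n / K) * (\<Sum>i\<in>{0..<n}. (y i)\<^sup>2)" by (simp add: algebra_simps)
    also have "\<dots> < 0"
    proof -
      obtain i where i: "i < n" "z $ i \<noteq> 0" using z by (metis carrier_vecD eq_vecI index_zero_vec)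
      have "(\<Sum>i\<in>{0..<n}. (y i)\<^sup>2) > 0" using i K1 by (intro sum_pos2[of _ i]) (auto simp: y_def)
      then show ?thesis using K\<delta> by (simp add: mult_neg_pos)
    qed
    finally show ?thesis .
  qed
  show ?thesis using K1 main by (intro that[of "\<lambda>i. (K ^ i)\<^sup>2"]) auto
qed

text \<open>Over the complex numbers the characteristic polynomial splits, so a Schur form exists.
  Similarity is passed on as the intertwining relation \<open>R * A = T * R\<close> with
  \<open>R\<close> injective, which is the shape needed to pull a form for \<open>T\<close> back to
  \<open>A\<close>.\<close>

lemma similar_upper_triangular_eigenvalues:
  fixes A :: "complex mat"
  assumes A: "A \<in> carrier_mat n n"
  obtains T R where "T \<in> carrier_mat n n" "R \<in> carrier_mat n n" "upper_triangular T" "R * A = T * R"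
    "\<And>v. v \<in> carrier_vec n \<Longrightarrow> R *\<^sub>v v = 0\<^sub>v n \<Longrightarrow> v = 0\<^sub>v n"
    "\<And>i. i < n \<Longrightarrow> eigenvalue A (T $$ (i, i))"
proof -
  obtain es where "char_poly A = (\<Prod>a\<leftarrow>es. [:- a, 1:])" using char_poly_factorized[OF A] by blast
  then obtain T where T: "T \<in> carrier_mat n n" "upper_triangular T" "similar_mat A T"
    using schur_decomposition_exists[OF A] by blast
  then obtain Q R where sim: "similar_mat_wit A T Q R" by (auto simp: similar_mat_def)
  note w = similar_mat_witD2[OF A sim]
  have "R * A = R * (Q * (T * R))" using w by (simp add: assoc_mult_mat[of _ n n _ n _ n])
  also have "\<dots> = (R * Q) * (T * R)" using w by (intro assoc_mult_mat[symmetric, of _ n n _ n _ n]) auto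
  finally have RA: "R * A = T * R" using w by simp
  have inj: "v = 0\<^sub>v n" if v: "v \<in> carrier_vec n" "R *\<^sub>v v = 0\<^sub>v n" for v
  proof -
    have "v = (Q * R) *\<^sub>v v" using w v by simp
    also have "\<dots> = Q *\<^sub>v (R *\<^sub>v v)" using w v by (intro assoc_mult_mat_vec) auto
    also have "\<dots> = 0\<^sub>v n" using w v by (auto simp: mult_mat_vec_def)
    finally show ?thesis .
  qed
  have "eigenvalue A (T $$ (i, i))" if i: "i < n" for i
  proof -
    have "char_poly A = (\<Prod>a\<leftarrow>diag_mat T. [:- a, 1:])"
      using char_poly_similar[OF T(3)] char_poly_upper_triangular[OF T(1,2)] by simp
    then have "poly (char_poly A) (T $$ (i, i)) = (\<Prod>a\<leftarrow>diag_mat T. T $$ (i, i) - a)"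
      by (simp add: poly_prod_list o_def)
    also have "\<dots> = 0" using i T(1) by (force simp: prod_list_zero_iff diag_mat_def)
    finally show ?thesis using eigenvalue_root_char_poly[OF A] by simp
  qed
  with T w RA inj show ?thesis using that by blast
qed

text \<open>The weighted form for the triangular matrix is pulled back along \<open>\<phi>\<close>,
  which embeds real vectors into complex ones and applies \<open>R\<close>. It intertwines
  \<open>M\<close> with \<open>T\<close>, so the negativity carries over.\<close>

lemma hurwitz_lyapunov:
  assumes M: "M \<in> carrier_mat n n" and hurwitz: "hurwitz M"
  obtains P where "pos_def_mat n P"
    "\<And>v. v \<in> carrier_vec n \<Longrightarrow> v \<noteq> 0\<^sub>v n \<Longrightarrow> v \<bullet> (P *\<^sub>v (M *\<^sub>v v)) < 0"
proof -
  define Mc where "Mc = map_mat complex_of_real M"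
  have Mc: "Mc \<in> carrier_mat n n" using M by (simp add: Mc_def)
  obtain T R where T: "T \<in> carrier_mat n n" "upper_triangular T" and R: "R \<in> carrier_mat n n"
    and RM: "R * Mc = T * R"
    and inj: "\<And>v. v \<in> carrier_vec n \<Longrightarrow> R *\<^sub>v v = 0\<^sub>v n \<Longrightarrow> v = 0\<^sub>v n"
    and ev: "\<And>i. i < n \<Longrightarrow> eigenvalue Mc (T $$ (i, i))"
    using similar_upper_triangular_eigenvalues[OF Mc] by metis
  have "Re (T $$ (i, i)) < 0" if "i < n" for i
    using hurwitz ev[OF that] by (simp add: hurwitz_def Mc_def)
  from upper_triangular_weighted_form_negative[OF T this] obtain w where w: "\<And>i. w i > 0"
    "\<And>z. z \<in> carrier_vec n \<Longrightarrow> z \<noteq> 0\<^sub>v n \<Longrightarrow> (\<Sum>i\<in>{0..<n}. w i * Re (cnj (z $ i) * (T *\<^sub>v z) $ i)) < 0"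
    by metis
  define \<phi> where "\<phi> v = R *\<^sub>v map_vec complex_of_real v" for v
  have \<phi>: "\<phi> v \<in> carrier_vec n" if "v \<in> carrier_vec n" for v using that R by (simp add: \<phi>_def)
  have \<phi>0: "\<phi> v \<noteq> 0\<^sub>v n" if v: "v \<in> carrier_vec n" "v \<noteq> 0\<^sub>v n" for v
  proof
    assume "\<phi> v = 0\<^sub>v n"
    then have "map_vec complex_of_real v = 0\<^sub>v n" using v by - (rule inj, auto simp: \<phi>_def)
    then have "v $ i = 0" if "i < n" for i
      using that v by (metis carrier_vecD index_map_vec(1) index_zero_vec(1) of_real_eq_0_iff)
    then show False using v by (metis carrier_vecD eq_vecI index_zero_vec)
  qed
  have \<phi>M: "\<phi> (M *\<^sub>v v) = T *\<^sub>v \<phi> v" if v: "v \<in> carrier_vec n" for v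
  proof -
    have "map_vec complex_of_real (M *\<^sub>v v) = Mc *\<^sub>v map_vec complex_of_real v"
      using M v by (simp add: Mc_def of_real_hom.mult_mat_vec_hom)
    then have "\<phi> (M *\<^sub>v v) = (R * Mc) *\<^sub>v map_vec complex_of_real v"
      using R Mc v by (simp add: \<phi>_def)
    also have "\<dots> = T *\<^sub>v \<phi> v" unfolding RM \<phi>_def using T R v by (intro assoc_mult_mat_vec) auto
    finally show ?thesis .
  qed
  \<comment> \<open>This is the real part of the Hermitian matrix \<open>R\<^sup>* W R\<close>, with
    \<open>W\<close> the diagonal matrix of the weights. The imaginary part is dropped to get a real
    symmetric matrix.\<close>
  define P where "P = mat n n (\<lambda>(j, k). \<Sum>i\<in>{0..<n}. w i * Re (cnj (R $$ (i, j)) * R $$ (i, k)))"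
  have P: "P \<in> carrier_mat n n" by (simp add: P_def)
  \<comment> \<open>Two arguments are needed: the pair \<open>v\<close>, \<open>v\<close> gives
    positivity, the pair \<open>v\<close>, \<open>M *\<^sub>v v\<close> the Lyapunov
    inequality.\<close>
  have form: "u \<bullet> (P *\<^sub>v v) = (\<Sum>i\<in>{0..<n}. w i * Re (cnj (\<phi> u $ i) * \<phi> v $ i))"
    if uv: "u \<in> carrier_vec n" "v \<in> carrier_vec n" for u v
  proof -
    have e: "\<phi> x $ i = (\<Sum>j\<in>{0..<n}. R $$ (i, j) * complex_of_real (x $ j))"
      if "x \<in> carrier_vec n" "i < n" for x i
      using that R by (auto simp: \<phi>_def scalar_prod_def)
    have "w i * Re (cnj (\<phi> u $ i) * \<phi> v $ i) = (\<Sum>j\<in>{0..<n}. \<Sum>k\<in>{0..<n}.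
        w i * Re (cnj (R $$ (i, j)) * R $$ (i, k)) * (u $ j * v $ k))" if i: "i < n" for i
      unfolding e[OF uv(1) i] e[OF uv(2) i] cnj_sum sum_product
      unfolding Re_sum sum_distrib_left
      by (intro sum.cong refl) (simp add: algebra_simps)
    then have "(\<Sum>i\<in>{0..<n}. w i * Re (cnj (\<phi> u $ i) * \<phi> v $ i)) = (\<Sum>i\<in>{0..<n}. \<Sum>j\<in>{0..<n}. \<Sum>k\<in>{0..<n}.
        w i * Re (cnj (R $$ (i, j)) * R $$ (i, k)) * (u $ j * v $ k))" by simp
    also have "\<dots> = (\<Sum>j\<in>{0..<n}. \<Sum>i\<in>{0..<n}. \<Sum>k\<in>{0..<n}.
        w i * Re (cnj (R $$ (i, j)) * R $$ (i, k)) * (u $ j * v $ k))" by (rule sum.swap)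
    also have "\<dots> = (\<Sum>j\<in>{0..<n}. \<Sum>k\<in>{0..<n}. \<Sum>i\<in>{0..<n}.
        w i * Re (cnj (R $$ (i, j)) * R $$ (i, k)) * (u $ j * v $ k))"
      by (intro sum.cong refl sum.swap)
    also have "\<dots> = (\<Sum>j\<in>{0..<n}. \<Sum>k\<in>{0..<n}. P $$ (j, k) * (u $ j * v $ k))"
      by (intro sum.cong refl) (simp add: P_def sum_distrib_right)
    also have "\<dots> = u \<bullet> (P *\<^sub>v v)" by (rule scalar_prod_mult_mat_vec_eq_sum[OF P uv, symmetric])
    finally show ?thesis by simp
  qed
  have "v \<bullet> (P *\<^sub>v v) > 0" if v: "v \<in> carrier_vec n" "v \<noteq> 0\<^sub>v n" for v
  proof -
    obtain i where i: "i < n" "\<phi> v $ i \<noteq> 0" using \<phi>[OF v(1)] \<phi>0[OF v]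
      by (metis carrier_vecD eq_vecI index_zero_vec)
    have sq: "Re (cnj x * x) = (cmod x)\<^sup>2" for x by (simp add: cmod_power2) (simp add: power2_eq_square)
    show ?thesis unfolding form[OF v(1) v(1)] sq using i w(1)
      by (intro sum_pos2[of _ i]) (auto intro!: mult_nonneg_nonneg less_imp_le[OF w(1)])
  qed
  moreover have "transpose_mat P = P"
    by (rule eq_matI) (auto simp: P_def algebra_simps intro!: sum.cong)
  ultimately have "pos_def_mat n P" using P by (simp add: pos_def_mat_def)
  moreover have "v \<bullet> (P *\<^sub>v (M *\<^sub>v v)) < 0" if v: "v \<in> carrier_vec n" "v \<noteq> 0\<^sub>v n" for v
    using w(2)[OF \<phi>[OF v(1)] \<phi>0[OF v]] M v(1) by (simp add: form \<phi>M)
  ultimately show ?thesis by (rule that)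
qed

text \<open>
  On vectors \<open>(0, v)\<close> the output vanishes, so the output injection drops out of the Lyapunov
  inequality, which becomes \<open>v \<bullet> (R3 E v + R4 S v) < 0\<close> in the lower blocks \<open>R3, R4\<close> of the Lyapunov
  matrix. Hence \<open>L = R4\<inverse> R3\<close> works.
\<close>

lemma detectable_block_observer_gain:
  assumes A: "A \<in> carrier_mat n n" and C: "C \<in> carrier_mat l n"
    and E: "E \<in> carrier_mat n q" and S: "S \<in> carrier_mat q q"
    and det: "detectable (block_row C (0\<^sub>m l q)) (four_block_mat A E (0\<^sub>m q n) S)"
  obtains L P where "L \<in> carrier_mat q n" "pos_def_mat q P"
    "\<And>v. v \<in> carrier_vec q \<Longrightarrow> v \<noteq> 0\<^sub>v q \<Longrightarrow> v \<bullet> (P *\<^sub>v ((S + L * E) *\<^sub>v v)) < 0"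
proof -
  define F where "F = four_block_mat A E (0\<^sub>m q n) S"
  define G where "G = block_row C (0\<^sub>m l q)"
  have F: "F \<in> carrier_mat (n + q) (n + q)" using A S by (simp add: F_def)
  have G: "G \<in> carrier_mat l (n + q)" using C by (auto simp: G_def block_row_def)
  have Gb: "G = four_block_mat C (0\<^sub>m l q) (0\<^sub>m 0 n) (0\<^sub>m 0 q)"
    using C by (simp add: G_def block_row_def)
  obtain J where J: "J \<in> carrier_mat (n + q) l" and hur: "hurwitz (F + J * G)"
    using det F G unfolding F_def[symmetric] G_def[symmetric] detectable_def by auto
  have FJG: "F + J * G \<in> carrier_mat (n + q) (n + q)" using F G J by simp
  obtain R where R: "pos_def_mat (n + q) R"
    and neg: "\<And>v. v \<in> carrier_vec (n + q) \<Longrightarrow> v \<noteq> 0\<^sub>v (n + q) \<Longrightarrow> v \<bullet> (R *\<^sub>v ((F + J * G) *\<^sub>v v)) < 0"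
    using hurwitz_lyapunov[OF FJG hur] by blast
  have Rc: "R \<in> carrier_mat (n + q) (n + q)" using R by (simp add: pos_def_mat_def)
  obtain R1 R2 R3 R4 where split: "split_block R n n = (R1, R2, R3, R4)" by (cases "split_block R n n")
  have Rb: "R1 \<in> carrier_mat n n" "R2 \<in> carrier_mat n q" "R3 \<in> carrier_mat q n" "R4 \<in> carrier_mat q q"
    "R = four_block_mat R1 R2 R3 R4"
    using split_block[OF split, of q q] Rc by auto
  have lift: "0\<^sub>v n @\<^sub>v v \<noteq> 0\<^sub>v (n + q)" if v: "v \<in> carrier_vec q" "v \<noteq> 0\<^sub>v q" for v :: "real vec"
  proof
    assume 0: "0\<^sub>v n @\<^sub>v v = 0\<^sub>v (n + q)"
    have "v $ i = 0" if "i < q" for i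
      using arg_cong[OF 0, of "\<lambda>u. u $ (n + i)"] that v by simp
    then show False using v by (metis carrier_vecD eq_vecI index_zero_vec)
  qed
  \<comment> \<open>Pairing with \<open>(0, v)\<close> on the left sees only the lower block row of
    \<open>R\<close>.\<close>
  have form: "(0\<^sub>v n @\<^sub>v v) \<bullet> (R *\<^sub>v (x @\<^sub>v y)) = v \<bullet> (R3 *\<^sub>v x + R4 *\<^sub>v y)"
    if "v \<in> carrier_vec q" "x \<in> carrier_vec n" "y \<in> carrier_vec q" for v x y
  proof -
    have "R *\<^sub>v (x @\<^sub>v y) = (R1 *\<^sub>v x + R2 *\<^sub>v y) @\<^sub>v (R3 *\<^sub>v x + R4 *\<^sub>v y)"
      unfolding Rb(5) using Rb(1-4) that by (intro four_block_mat_mult_vec)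
    then show ?thesis using Rb that by (simp add: scalar_prod_append[of _ n _ q])
  qed
  have z0: "M *\<^sub>v 0\<^sub>v n = 0\<^sub>v k" if "M \<in> carrier_mat k n" for M :: "real mat" and k
    using that by (auto simp: mult_mat_vec_def)
  \<comment> \<open>A principal block inherits symmetry and positivity; the test vectors are again
    \<open>(0, v)\<close>.\<close>
  have R4: "pos_def_mat q R4"
  proof -
    have "transpose_mat R = R" using R by (simp add: pos_def_mat_def)
    have "transpose_mat R4 = R4"
    proof (rule eq_matI)
      fix i j assume ij: "i < dim_row R4" "j < dim_col R4"
      then have "R $$ (n + i, n + j) = R $$ (n + j, n + i)" using \<open>transpose_mat R = R\<close> Rc Rb
        by (metis add_less_cancel_left carrier_matD index_transpose_mat(1))
      then show "transpose_mat R4 $$ (i, j) = R4 $$ (i, j)" using ij Rb(1-4) by (simp add: Rb(5))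
    qed (use Rb in auto)
    moreover have "v \<bullet> (R4 *\<^sub>v v) > 0" if v: "v \<in> carrier_vec q" "v \<noteq> 0\<^sub>v q" for v
    proof -
      have "(0\<^sub>v n @\<^sub>v v) \<bullet> (R *\<^sub>v (0\<^sub>v n @\<^sub>v v)) > 0"
        using R lift[OF v] v by (simp add: pos_def_mat_def)
      then show ?thesis using v Rb(1-4) z0[OF Rb(3)] by (simp add: form)
    qed
    ultimately show ?thesis using Rb by (simp add: pos_def_mat_def)
  qed
  define L where "L = the (mat_inverse R4) * R3"
  note inv = pos_def_mat_inverse[OF R4]
  have L: "L \<in> carrier_mat q n" using inv Rb by (simp add: L_def)
  have R4L: "R4 *\<^sub>v (L *\<^sub>v x) = R3 *\<^sub>v x" if x: "x \<in> carrier_vec n" for x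
  proof -
    have "L *\<^sub>v x = the (mat_inverse R4) *\<^sub>v (R3 *\<^sub>v x)"
      unfolding L_def using inv Rb x by (intro assoc_mult_mat_vec) auto
    then have "R4 *\<^sub>v (L *\<^sub>v x) = (R4 * the (mat_inverse R4)) *\<^sub>v (R3 *\<^sub>v x)"
      using inv(1) Rb x by (simp add: assoc_mult_mat_vec[of R4 q q _ q])
    then show ?thesis using inv(2) Rb x by simp
  qed
  have "v \<bullet> (R4 *\<^sub>v ((S + L * E) *\<^sub>v v)) < 0" if v: "v \<in> carrier_vec q" "v \<noteq> 0\<^sub>v q" for v
  proof -
    let ?u = "0\<^sub>v n @\<^sub>v v"
    have u: "?u \<in> carrier_vec (n + q)" using v by simp
    have Fu: "F *\<^sub>v ?u = (E *\<^sub>v v) @\<^sub>v (S *\<^sub>v v)"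
    proof -
      have "F *\<^sub>v ?u = (A *\<^sub>v 0\<^sub>v n + E *\<^sub>v v) @\<^sub>v (0\<^sub>m q n *\<^sub>v 0\<^sub>v n + S *\<^sub>v v)"
        unfolding F_def using A E S v by (intro four_block_mat_mult_vec) auto
      then show ?thesis using z0[OF A] z0[of "0\<^sub>m q n" q] E S v by simp
    qed
    have Gu: "G *\<^sub>v ?u = 0\<^sub>v l"
    proof -
      have "G *\<^sub>v ?u = (C *\<^sub>v 0\<^sub>v n + 0\<^sub>m l q *\<^sub>v v) @\<^sub>v (0\<^sub>m 0 n *\<^sub>v 0\<^sub>v n + 0\<^sub>m 0 q *\<^sub>v v)"
        unfolding Gb using C v by (intro four_block_mat_mult_vec) auto
      also have "\<dots> = 0\<^sub>v l" using z0[OF C] v by (intro eq_vecI) auto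
      finally show ?thesis .
    qed
    have "(J * G) *\<^sub>v ?u = J *\<^sub>v (G *\<^sub>v ?u)"
      using J G u by (intro assoc_mult_mat_vec) auto
    also have "\<dots> = 0\<^sub>v (n + q)" unfolding Gu using J by (auto simp: mult_mat_vec_def)
    finally have "(F + J * G) *\<^sub>v ?u = (E *\<^sub>v v) @\<^sub>v (S *\<^sub>v v)"
      using F J G u E S v by (simp add: add_mult_distrib_mat_vec[of _ "n + q" "n + q"] Fu)
    then have "v \<bullet> (R3 *\<^sub>v (E *\<^sub>v v) + R4 *\<^sub>v (S *\<^sub>v v)) < 0"
      using neg[OF u lift[OF v]] E S v by (simp add: form)
    \<comment> \<open>Since \<open>R4 * L\<close> acts as \<open>R3\<close>, the lower block of the
      Lyapunov inequality is itself a Lyapunov inequality for \<open>S + L * E\<close>, with matrix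
      \<open>R4\<close>.\<close>
    moreover have "R4 *\<^sub>v ((S + L * E) *\<^sub>v v) = R3 *\<^sub>v (E *\<^sub>v v) + R4 *\<^sub>v (S *\<^sub>v v)"
    proof -
      have "(S + L * E) *\<^sub>v v = S *\<^sub>v v + L *\<^sub>v (E *\<^sub>v v)"
        using S L E v by (simp add: add_mult_distrib_mat_vec[of _ q q] assoc_mult_mat_vec[of L q n E q])
      then have "R4 *\<^sub>v ((S + L * E) *\<^sub>v v) = R4 *\<^sub>v (S *\<^sub>v v) + R4 *\<^sub>v (L *\<^sub>v (E *\<^sub>v v))"
        using S L E v Rb by (simp add: mult_add_distrib_mat_vec[of _ q q])
      then show ?thesis using R4L[of "E *\<^sub>v v"] E S v Rb by (simp add: comm_add_vec[of _ q])
    qed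
    ultimately show ?thesis by simp
  qed
  with L R4 show ?thesis by (rule that)
qed

subsection \<open>Piecewise differentiable trajectories\<close>

text \<open>The dwell time excludes an accumulation of switching instants: \<open>ts k\<close> is at
  least \<open>real k * \<tau>\<close>.\<close>

lemma switching_signal_times:
  assumes "switching_signal \<kappa> \<tau> ts \<sigma>"
  shows "ts 0 = 0" "ts k < ts (Suc k)" "0 \<le> ts k" "\<exists>k. t < ts k"
    "s \<in> {ts k..<ts (Suc k)} \<Longrightarrow> 0 \<le> s"
proof -
  have \<tau>: "\<tau> > 0" "ts (Suc k) \<ge> ts k + \<tau>" for k
    using assms by (simp_all add: switching_signal_def algebra_simps)
  show "ts 0 = 0" using assms by (simp add: switching_signal_def)
  then have ge: "real k * \<tau> \<le> ts k" for k
  proof (induction k)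
    case (Suc k)
    then show ?case using \<tau>(2)[of k] by (simp add: algebra_simps)
  qed simp
  show "ts k < ts (Suc k)" using \<tau>(1) \<tau>(2)[of k] by simp
  have k0: "0 \<le> ts k" for k using ge[of k] \<tau>(1) by (meson mult_nonneg_nonneg of_nat_0_le_iff less_imp_le order.trans)
  then show "0 \<le> ts k" .
  obtain j :: nat where "t / \<tau> < real j" using reals_Archimedean2 by blast
  then have "t < real j * \<tau>" using \<tau>(1) by (simp add: field_simps)
  then show "\<exists>k. t < ts k" using ge[of j] by (intro exI[of _ j]) linarith
  show "s \<in> {ts k..<ts (Suc k)} \<Longrightarrow> 0 \<le> s" using k0[of k] by auto
qed

text \<open>Induction over the switching intervals. Monotonicity on each of them comes from the
  derivative in the interior, and continuity carries the bound across the switching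
  instants.\<close>

lemma piecewise_nonpos_derivative_le:
  fixes h :: "real \<Rightarrow> real"
  assumes sw: "switching_signal \<kappa> \<tau> ts \<sigma>"
    and cont: "continuous_on {0..} h"
    and deriv: "\<And>k t. t \<in> {ts k..<ts (Suc k)} \<Longrightarrow>
        (h has_real_derivative h' t) (at t within {ts k..<ts (Suc k)})"
    and nonpos: "\<And>t. t \<ge> T \<Longrightarrow> h' t \<le> 0" and T: "T \<ge> 0" and t: "T \<le> t"
  shows "h t \<le> h T"
proof -
  have "\<forall>t. T \<le> t \<longrightarrow> t \<le> ts k \<longrightarrow> h t \<le> h T" for k
  proof (induction k)
    case 0
    then show ?case using T switching_signal_times(1)[OF sw] by (metis dual_order.trans order.antisym order_refl)
  next
    case (Suc k)
    show ?case
    proof (intro allI impI)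
      fix t assume t: "T \<le> t" "t \<le> ts (Suc k)"
      show "h t \<le> h T"
      proof (cases "t \<le> ts k")
        case True
        then show ?thesis using Suc t by blast
      next
        case False
        \<comment> \<open>The part of the current interval that counts begins at
          \<open>ts k\<close>, or at \<open>T\<close> if \<open>T\<close> lies inside it.\<close>
        define s where "s = max T (ts k)"
        have s: "T \<le> s" "ts k \<le> s" "s \<le> t" using t False by (auto simp: s_def)
        have "h t \<le> h s"
        proof (rule DERIV_nonpos_imp_decreasing_open[OF s(3)])
          fix x assume x: "s < x" "x < t"
          then have x': "x \<in> {ts k..<ts (Suc k)}" "x \<in> {ts k<..<ts (Suc k)}" "T \<le> x" using s t by auto
          have "at x within {ts k..<ts (Suc k)} = at x"
            using x'(2) by (intro at_within_open_subset[of _ "{ts k<..<ts (Suc k)}"]) auto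
          then show "\<exists>y. (h has_real_derivative y) (at x) \<and> y \<le> 0"
            using deriv[OF x'(1)] nonpos[OF x'(3)] by auto
        next
          show "continuous_on {s..t} h" using s T by (intro continuous_on_subset[OF cont]) auto
        qed
        moreover have "h s \<le> h T"
        proof (cases "T \<le> ts k")
          case True
          then show ?thesis using Suc by (simp add: s_def)
        qed (simp add: s_def)
        ultimately show ?thesis by simp
      qed
    qed
  qed
  moreover obtain k where "t < ts k" using switching_signal_times(4)[OF sw] by blast
  ultimately show ?thesis using t by (meson less_imp_le)
qed

text \<open>A Gronwall argument. Once \<open>g\<close> is below \<open>c * \<epsilon>\<close>, the
  input is absorbed by shifting \<open>V\<close> down by \<open>\<epsilon>\<close>, and the
  integrating factor \<open>exp (c * t)\<close> makes the shifted function nonincreasing.\<close>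

lemma dissipation_inequality_tendsto_zero:
  fixes V :: "real \<Rightarrow> real"
  assumes sw: "switching_signal \<kappa> \<tau> ts \<sigma>"
    and cont: "continuous_on {0..} V"
    and deriv: "\<And>k t. t \<in> {ts k..<ts (Suc k)} \<Longrightarrow>
        (V has_real_derivative V' t) (at t within {ts k..<ts (Suc k)})"
    and nonneg: "\<And>t. t \<ge> 0 \<Longrightarrow> V t \<ge> 0"
    and c: "c > 0" and g: "(g \<longlongrightarrow> 0) at_top"
    and diss: "\<And>t. t \<ge> 0 \<Longrightarrow> V' t \<le> - c * V t + g t"
  shows "(V \<longlongrightarrow> 0) at_top"
proof (rule tendstoI)
  fix e :: real assume e: "e > 0"
  \<comment> \<open>One half of \<open>e\<close> pays for the shift, the other for the decaying
    contribution of the value at time \<open>T\<close>.\<close>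
  define \<epsilon> where "\<epsilon> = e / 2"
  have "\<forall>\<^sub>F t in at_top. g t < c * \<epsilon>" using g c e by (intro order_tendstoD) (auto simp: \<epsilon>_def)
  then obtain T0 where T0: "\<And>t. t \<ge> T0 \<Longrightarrow> g t < c * \<epsilon>" by (auto simp: eventually_at_top_linorder)
  define T where "T = max T0 0"
  have T: "T \<ge> 0" "\<And>t. t \<ge> T \<Longrightarrow> g t < c * \<epsilon>" using T0 by (auto simp: T_def)
  define h where "h t = exp (c * t) * (V t - \<epsilon>)" for t
  have bound: "h t \<le> h T" if "t \<ge> T" for t
  proof (rule piecewise_nonpos_derivative_le[OF sw _ _ _ T(1) that])
    show "continuous_on {0..} h" unfolding h_def by (intro continuous_intros cont)
    show "(h has_real_derivative exp (c * t) * (c * (V t - \<epsilon>) + V' t)) (at t within {ts k..<ts (Suc k)})"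
      if "t \<in> {ts k..<ts (Suc k)}" for k t
      unfolding h_def by (auto intro!: derivative_eq_intros deriv[OF that] simp: algebra_simps)
    show "exp (c * t) * (c * (V t - \<epsilon>) + V' t) \<le> 0" if "t \<ge> T" for t
    proof (intro mult_nonneg_nonpos)
      have "V' t \<le> - c * V t + g t" using that T(1) by (intro diss) simp
      then show "c * (V t - \<epsilon>) + V' t \<le> 0" using T(2)[OF that] by (simp add: algebra_simps)
    qed simp
  qed
  have "filterlim (\<lambda>t. c * t) at_top at_top"
    using c by (intro filterlim_tendsto_pos_mult_at_top[OF tendsto_const]) (auto intro: filterlim_ident)
  then have "LIM t at_top. - (c * t) :> at_bot" by (simp add: filterlim_uminus_at_bot)
  then have "((\<lambda>t. exp (- (c * t))) \<longlongrightarrow> 0) at_top" by (rule filterlim_compose[OF exp_at_bot])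
  then have "((\<lambda>t. exp (- (c * t)) * h T) \<longlongrightarrow> 0) at_top" by (rule tendsto_mult_left_zero)
  then have "\<forall>\<^sub>F t in at_top. exp (- (c * t)) * h T < \<epsilon>" using e by (intro order_tendstoD) (auto simp: \<epsilon>_def)
  moreover have "\<forall>\<^sub>F t in at_top. t \<ge> T" by (rule eventually_ge_at_top)
  ultimately show "\<forall>\<^sub>F t in at_top. dist (V t) 0 < e"
  proof eventually_elim
    case (elim t)
    have "V t - \<epsilon> = exp (- (c * t)) * h t" by (simp add: h_def exp_minus field_simps)
    also have "\<dots> \<le> exp (- (c * t)) * h T" using bound[OF elim(2)] by (intro mult_left_mono) auto
    finally have "V t < e" using elim(1) by (simp add: \<epsilon>_def)
    moreover have "V t \<ge> 0" using nonneg elim(2) T(1) by simp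
    ultimately show ?case by simp
  qed
qed

text \<open>Dissipation is required only of the sum over the family, because the communication graph
  couples its members. The right-hand sides may jump; one fixed \<open>P\<close> for all times keeps
  the total energy continuous across the jumps.\<close>

lemma lyapunov_family_tends_to_zero:
  assumes sw: "switching_signal \<kappa> \<tau> ts \<sigma>" and fin: "finite I" and P: "pos_def_mat n P"
    and sol: "\<And>i. i \<in> I \<Longrightarrow> solves_ode ts n (f i) (g i)"
    and g: "\<And>i t. i \<in> I \<Longrightarrow> t \<ge> 0 \<Longrightarrow> g i t \<in> carrier_vec n"
    and \<alpha>: "\<alpha> > 0" and h: "(h \<longlongrightarrow> 0) at_top"
    and diss: "\<And>t. t \<ge> 0 \<Longrightarrow>
        (\<Sum>i\<in>I. f i t \<bullet> (P *\<^sub>v g i t)) \<le> - \<alpha> * (\<Sum>i\<in>I. f i t \<bullet> f i t) + h t"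
    and i: "i \<in> I"
  shows "tends_to_zero n (f i)"
proof -
  have Pc: "P \<in> carrier_mat n n" "transpose_mat P = P" using P by (auto simp: pos_def_mat_def)
  have f: "f i t \<in> carrier_vec n" if "i \<in> I" "t \<ge> 0" for i t
    using sol[OF that(1)] that(2) by (simp add: solves_ode_def)
  obtain c where c: "c > 0" "\<And>v. v \<in> carrier_vec n \<Longrightarrow> c * (v \<bullet> v) \<le> v \<bullet> (P *\<^sub>v v)"
    using positive_form_coercive[OF Pc(1)] P by (metis pos_def_mat_def)
  obtain K where K: "K > 0" "\<And>v. v \<in> carrier_vec n \<Longrightarrow> \<bar>v \<bullet> (P *\<^sub>v v)\<bar> \<le> K * (v \<bullet> v)"
    using quadratic_form_bounded[OF Pc(1)] by blast
  \<comment> \<open>Derivatives are available for components only, so the energy is written as a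
    polynomial in them.\<close>
  define V where "V t = (\<Sum>i\<in>I. \<Sum>a\<in>{0..<n}. \<Sum>b\<in>{0..<n}. P $$ (a, b) * (f i t $ a * f i t $ b))" for t
  define V' where "V' t = (\<Sum>i\<in>I. \<Sum>a\<in>{0..<n}. \<Sum>b\<in>{0..<n}.
      P $$ (a, b) * (g i t $ a * f i t $ b + f i t $ a * g i t $ b))" for t
  have V: "V t = (\<Sum>i\<in>I. f i t \<bullet> (P *\<^sub>v f i t))" if "t \<ge> 0" for t
    unfolding V_def using f that by (intro sum.cong refl scalar_prod_mult_mat_vec_eq_sum[OF Pc(1), symmetric])
  have V': "V' t = 2 * (\<Sum>i\<in>I. f i t \<bullet> (P *\<^sub>v g i t))" if t: "t \<ge> 0" for t
  proof -
    have "V' t = (\<Sum>i\<in>I. g i t \<bullet> (P *\<^sub>v f i t) + f i t \<bullet> (P *\<^sub>v g i t))"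
      unfolding V'_def using f g t
      by (intro sum.cong refl) (simp add: scalar_prod_mult_mat_vec_eq_sum[OF Pc(1)] sum.distrib algebra_simps)
    also have "\<dots> = (\<Sum>i\<in>I. 2 * (f i t \<bullet> (P *\<^sub>v g i t)))"
      using f g t by (intro sum.cong refl) (simp add: symmetric_scalar_prod[OF Pc, of "f _ t" "g _ t"])
    finally show ?thesis by (simp add: sum_distrib_left)
  qed
  have "(V \<longlongrightarrow> 0) at_top"
  proof (rule dissipation_inequality_tendsto_zero[OF sw])
    show "continuous_on {0..} V" unfolding V_def
      using sol by (intro continuous_intros) (auto simp: solves_ode_def)
    show "(V has_real_derivative V' t) (at t within {ts k..<ts (Suc k)})"
      if t: "t \<in> {ts k..<ts (Suc k)}" for k t
    proof -
      have d: "((\<lambda>s. f i s $ a) has_real_derivative g i t $ a) (at t within {ts k..<ts (Suc k)})"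
        if "i \<in> I" "a < n" for i a using sol[OF that(1)] that(2) t by (auto simp: solves_ode_def)
      show ?thesis unfolding V_def V'_def
        by (intro DERIV_sum DERIV_cmult) (auto intro!: derivative_eq_intros d)
    qed
    show "V t \<ge> 0" if "t \<ge> 0" for t
      unfolding V[OF that]
    proof (rule sum_nonneg)
      fix i assume "i \<in> I"
      from c(2)[OF f[OF this that]] c(1) scalar_prod_self_nonneg[of "f i t"]
      show "0 \<le> f i t \<bullet> (P *\<^sub>v f i t)" by (meson mult_nonneg_nonneg less_imp_le order.trans)
    qed
    \<comment> \<open>The rate: the energy is at most \<open>K\<close> times the sum of the squared
      lengths, and its derivative is twice the dissipated form by the symmetry of
      \<open>P\<close>.\<close>
    show "2 * \<alpha> / K > 0" using \<alpha> K by simp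
    show "((\<lambda>t. 2 * h t) \<longlongrightarrow> 0) at_top" using tendsto_mult_right_zero[OF h] .
    show "V' t \<le> - (2 * \<alpha> / K) * V t + 2 * h t" if t: "t \<ge> 0" for t
    proof -
      have "V t \<le> (\<Sum>i\<in>I. K * (f i t \<bullet> f i t))"
        unfolding V[OF t] using K(2) f t by (intro sum_mono) (auto intro: order.trans[OF abs_ge_self])
      then have "V t / K \<le> (\<Sum>i\<in>I. f i t \<bullet> f i t)"
        using K(1) by (simp add: field_simps sum_distrib_left)
      then have "\<alpha> * (V t / K) \<le> \<alpha> * (\<Sum>i\<in>I. f i t \<bullet> f i t)" using \<alpha> by (intro mult_left_mono) auto
      moreover have "- (2 * \<alpha> / K) * V t = - 2 * (\<alpha> * (V t / K))" by simp
      ultimately show ?thesis using diss[OF t] unfolding V'[OF t] by linarith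
    qed
  qed
  then have lim: "((\<lambda>t. V t / c) \<longlongrightarrow> 0) at_top" using tendsto_divide[OF _ tendsto_const, of V 0 at_top c] c(1) by simp
  show ?thesis unfolding tends_to_zero_def
  proof (intro allI impI)
    fix a assume a: "a < n"
    have "(f i t $ a)\<^sup>2 \<le> V t / c" if t: "t \<ge> 0" for t
    proof -
      have "(f i t $ a)\<^sup>2 \<le> f i t \<bullet> f i t"
        using f[OF i t] a by (intro square_index_le_scalar_prod_self) auto
      then have "c * (f i t $ a)\<^sup>2 \<le> c * (f i t \<bullet> f i t)" using c(1) by simp
      also have "\<dots> \<le> f i t \<bullet> (P *\<^sub>v f i t)" using c(2) f[OF i t] .
      also have "\<dots> \<le> V t" unfolding V[OF t]
      proof (rule member_le_sum[OF i _ fin])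
        fix j assume "j \<in> I - {i}"
        then have "c * (f j t \<bullet> f j t) \<le> f j t \<bullet> (P *\<^sub>v f j t)" using c(2) f t by simp
        then show "0 \<le> f j t \<bullet> (P *\<^sub>v f j t)"
          using c(1) scalar_prod_self_nonneg[of "f j t"] by (meson mult_nonneg_nonneg less_imp_le order.trans)
      qed
      finally show ?thesis using c(1) by (simp add: field_simps)
    qed
    then have "\<forall>\<^sub>F t in at_top. (f i t $ a)\<^sup>2 \<le> V t / c"
      using eventually_ge_at_top[of 0] by (rule eventually_mono[rotated])
    then have "((\<lambda>t. (f i t $ a)\<^sup>2) \<longlongrightarrow> 0) at_top"
      by (intro tendsto_sandwich[OF _ _ tendsto_const lim]) auto
    then have "((\<lambda>t. sqrt ((f i t $ a)\<^sup>2)) \<longlongrightarrow> sqrt 0) at_top" by (rule tendsto_real_sqrt)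
    then show "((\<lambda>t. f i t $ a) \<longlongrightarrow> 0) at_top" by (simp add: tendsto_rabs_zero_iff)
  qed
qed

section \<open>Limits of vector-valued functions\<close>

lemma tends_to_zero_cong:
  assumes "tends_to_zero n f" "\<And>t. t \<ge> 0 \<Longrightarrow> f t = g t"
  shows "tends_to_zero n g"
  unfolding tends_to_zero_def
proof (intro allI impI)
  fix c assume "c < n"
  then have "((\<lambda>t. f t $ c) \<longlongrightarrow> 0) at_top" using assms(1) by (simp add: tends_to_zero_def)
  moreover have "\<forall>\<^sub>F t in at_top. f t $ c = g t $ c"
    using eventually_ge_at_top[of 0] by eventually_elim (simp add: assms(2))
  ultimately show "((\<lambda>t. g t $ c) \<longlongrightarrow> 0) at_top" by (rule Lim_transform_eventually)
qed

lemma tends_to_zero_add: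
  assumes "tends_to_zero n f" "tends_to_zero n g" "\<And>t. t \<ge> 0 \<Longrightarrow> g t \<in> carrier_vec n"
  shows "tends_to_zero n (\<lambda>t. f t + g t)"
  unfolding tends_to_zero_def
proof (intro allI impI)
  fix c assume c: "c < n"
  have "((\<lambda>t. f t $ c + g t $ c) \<longlongrightarrow> 0) at_top"
    using assms(1,2) c by (intro tendsto_add_zero) (auto simp: tends_to_zero_def)
  moreover have "\<forall>\<^sub>F t in at_top. f t $ c + g t $ c = (f t + g t) $ c"
    using eventually_ge_at_top[of 0] by eventually_elim (use carrier_vecD[OF assms(3)] c in auto)
  ultimately show "((\<lambda>t. (f t + g t) $ c) \<longlongrightarrow> 0) at_top" by (rule Lim_transform_eventually)
qed

lemma tends_to_zero_mult_mat_vec: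
  assumes "tends_to_zero n f" "\<And>t. t \<ge> 0 \<Longrightarrow> f t \<in> carrier_vec n" "A \<in> carrier_mat k n"
  shows "tends_to_zero k (\<lambda>t. A *\<^sub>v f t)"
  unfolding tends_to_zero_def
proof (intro allI impI)
  fix c assume c: "c < k"
  have "((\<lambda>t. \<Sum>j\<in>{0..<n}. A $$ (c, j) * f t $ j) \<longlongrightarrow> 0) at_top"
    using assms(1) by (intro tendsto_null_sum tendsto_mult_right_zero) (auto simp: tends_to_zero_def)
  moreover have "\<forall>\<^sub>F t in at_top. (\<Sum>j\<in>{0..<n}. A $$ (c, j) * f t $ j) = (A *\<^sub>v f t) $ c"
    using eventually_ge_at_top[of 0]
    by eventually_elim (use carrier_vecD[OF assms(2)] assms(3) c in \<open>simp add: scalar_prod_def\<close>)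
  ultimately show "((\<lambda>t. (A *\<^sub>v f t) $ c) \<longlongrightarrow> 0) at_top" by (rule Lim_transform_eventually)
qed

lemma tends_to_zero_scalar_prod_self:
  assumes "tends_to_zero n f" "\<And>t. t \<ge> 0 \<Longrightarrow> f t \<in> carrier_vec n"
  shows "((\<lambda>t. f t \<bullet> f t) \<longlongrightarrow> 0) at_top"
proof -
  have "((\<lambda>t. \<Sum>j\<in>{0..<n}. f t $ j * f t $ j) \<longlongrightarrow> 0) at_top"
    using assms(1) by (intro tendsto_null_sum tendsto_mult_zero) (auto simp: tends_to_zero_def)
  moreover have "\<forall>\<^sub>F t in at_top. (\<Sum>j\<in>{0..<n}. f t $ j * f t $ j) = f t \<bullet> f t"
    using eventually_ge_at_top[of 0]
    by eventually_elim (use carrier_vecD[OF assms(2)] in \<open>simp add: scalar_prod_def\<close>)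
  ultimately show ?thesis by (rule Lim_transform_eventually)
qed

section \<open>Linear operations on piecewise differentiable solutions\<close>

lemma solves_ode_carrier: "solves_ode ts n f g \<Longrightarrow> t \<ge> 0 \<Longrightarrow> f t \<in> carrier_vec n"
  by (simp add: solves_ode_def)

text \<open>Dimensions are known for nonnegative times only, hence so are the algebraic identities
  that rewrite a right-hand side.\<close>

lemma solves_ode_cong:
  assumes "switching_signal \<kappa> \<tau> ts \<sigma>" "solves_ode ts n f g" "\<And>t. t \<ge> 0 \<Longrightarrow> g t = h t"
  shows "solves_ode ts n f h"
  unfolding solves_ode_def
proof (intro conjI)
  show "\<forall>k. \<forall>t\<in>{ts k..<ts (Suc k)}. \<forall>c<n.
      ((\<lambda>s. f s $ c) has_real_derivative h t $ c) (at t within {ts k..<ts (Suc k)})"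
  proof (intro allI ballI impI)
    fix k t c assume *: "t \<in> {ts k..<ts (Suc k)}" "c < n"
    then have "g t = h t" using switching_signal_times(5)[OF assms(1)] assms(3) by blast
    moreover have "((\<lambda>s. f s $ c) has_real_derivative g t $ c) (at t within {ts k..<ts (Suc k)})"
      using * assms(2) by (simp add: solves_ode_def)
    ultimately show "((\<lambda>s. f s $ c) has_real_derivative h t $ c) (at t within {ts k..<ts (Suc k)})" by simp
  qed
qed (use assms(2) in \<open>auto simp: solves_ode_def\<close>)

lemma solves_ode_minus:
  assumes sw: "switching_signal \<kappa> \<tau> ts \<sigma>"
    and f: "solves_ode ts n f f'" and g: "solves_ode ts n g g'"
    and g': "\<And>t. t \<ge> 0 \<Longrightarrow> g' t \<in> carrier_vec n"
  shows "solves_ode ts n (\<lambda>t. f t - g t) (\<lambda>t. f' t - g' t)"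
  unfolding solves_ode_def
proof (intro conjI allI ballI impI)
  have e: "(f t - g t) $ c = f t $ c - g t $ c" if "t \<ge> 0" "c < n" for t c
    using solves_ode_carrier[OF g that(1)] that(2) by auto
  show "f t - g t \<in> carrier_vec n" if "t \<ge> 0" for t
    using solves_ode_carrier[OF f that] solves_ode_carrier[OF g that] by auto
  show "continuous_on {0..} (\<lambda>t. (f t - g t) $ c)" if "c < n" for c
  proof (rule continuous_on_cong[THEN iffD1, OF refl])
    show "continuous_on {0..} (\<lambda>t. f t $ c - g t $ c)"
      using f g that by (intro continuous_intros) (auto simp: solves_ode_def)
  qed (use e that in auto)
  fix k t c assume t: "t \<in> {ts k..<ts (Suc k)}" and c: "c < n"
  note nonneg = switching_signal_times(5)[OF sw]
  have "f' t $ c - g' t $ c = (f' t - g' t) $ c" using carrier_vecD[OF g'[OF nonneg[OF t]]] c by simp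
  moreover have "((\<lambda>s. f s $ c - g s $ c) has_real_derivative f' t $ c - g' t $ c) (at t within {ts k..<ts (Suc k)})"
    using f g t c by (intro DERIV_diff) (auto simp: solves_ode_def)
  ultimately have "((\<lambda>s. f s $ c - g s $ c) has_real_derivative (f' t - g' t) $ c) (at t within {ts k..<ts (Suc k)})"
    by (simp only:)
  then show "((\<lambda>t. (f t - g t) $ c) has_real_derivative (f' t - g' t) $ c) (at t within {ts k..<ts (Suc k)})"
    \<comment> \<open>The radius \<open>d = 1\<close> is arbitrary, as the two functions agree on
      the whole switching interval.\<close>
    by (rule has_field_derivative_transform_within[where f = "\<lambda>s. f s $ c - g s $ c" and d = 1])
      (use t e[OF nonneg c] in auto)
qed

lemma solves_ode_mult_mat_vec:
  assumes sw: "switching_signal \<kappa> \<tau> ts \<sigma>" and f: "solves_ode ts n f g"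
    and g: "\<And>t. t \<ge> 0 \<Longrightarrow> g t \<in> carrier_vec n" and A: "A \<in> carrier_mat k n"
  shows "solves_ode ts k (\<lambda>t. A *\<^sub>v f t) (\<lambda>t. A *\<^sub>v g t)"
  unfolding solves_ode_def
proof (intro conjI allI ballI impI)
  have e: "(A *\<^sub>v v) $ c = (\<Sum>j\<in>{0..<n}. A $$ (c, j) * v $ j)" if "v \<in> carrier_vec n" "c < k" for v c
    using that A by (auto simp: scalar_prod_def intro!: sum.cong)
  show "A *\<^sub>v f t \<in> carrier_vec k" if "t \<ge> 0" for t
    using solves_ode_carrier[OF f that] A by auto
  show "continuous_on {0..} (\<lambda>t. (A *\<^sub>v f t) $ c)" if "c < k" for c
  proof (rule continuous_on_cong[THEN iffD1, OF refl])
    show "continuous_on {0..} (\<lambda>t. \<Sum>j\<in>{0..<n}. A $$ (c, j) * f t $ j)"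
      using f by (intro continuous_intros) (auto simp: solves_ode_def)
  qed (use e that solves_ode_carrier[OF f] in auto)
  fix l t c assume t: "t \<in> {ts l..<ts (Suc l)}" and c: "c < k"
  note nonneg = switching_signal_times(5)[OF sw]
  have "((\<lambda>s. \<Sum>j\<in>{0..<n}. A $$ (c, j) * f s $ j) has_real_derivative (\<Sum>j\<in>{0..<n}. A $$ (c, j) * g t $ j))
      (at t within {ts l..<ts (Suc l)})"
    using f t by (intro DERIV_sum DERIV_cmult) (auto simp: solves_ode_def)
  then show "((\<lambda>t. (A *\<^sub>v f t) $ c) has_real_derivative (A *\<^sub>v g t) $ c) (at t within {ts l..<ts (Suc l)})"
    unfolding e[OF g[OF nonneg[OF t]] c]
    by (rule has_field_derivative_transform_within[where d = 1])
      (use t e[OF solves_ode_carrier[OF f nonneg] c] in \<open>auto simp del: index_mult_mat_vec\<close>)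
qed

text \<open>The strict Lyapunov inequality leaves a margin \<open>c\<close>. Half of it pays for the
  cross term between the state and the input, and what remains of the input vanishes in the
  limit.\<close>

lemma perturbed_lyapunov_tends_to_zero:
  assumes sw: "switching_signal \<kappa> \<tau> ts \<sigma>" and M: "M \<in> carrier_mat n n" and P: "pos_def_mat n P"
    and neg: "\<And>v. v \<in> carrier_vec n \<Longrightarrow> v \<noteq> 0\<^sub>v n \<Longrightarrow> v \<bullet> (P *\<^sub>v (M *\<^sub>v v)) < 0"
    and sol: "solves_ode ts n f (\<lambda>t. M *\<^sub>v f t + h t)"
    and h: "\<And>t. t \<ge> 0 \<Longrightarrow> h t \<in> carrier_vec n" "tends_to_zero n h"
  shows "tends_to_zero n f"
proof -
  have Pc: "P \<in> carrier_mat n n" using P by (simp add: pos_def_mat_def)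
  note f = solves_ode_carrier[OF sol]
  have PM: "- (P * M) \<in> carrier_mat n n" using Pc M by simp
  have PMv: "v \<bullet> (- (P * M) *\<^sub>v v) = - (v \<bullet> (P *\<^sub>v (M *\<^sub>v v)))" if "v \<in> carrier_vec n" for v
    using Pc M that by (simp add: assoc_mult_mat_vec[of _ n n _ n])
  obtain c where c: "c > 0" "\<And>v. v \<in> carrier_vec n \<Longrightarrow> c * (v \<bullet> v) \<le> v \<bullet> (- (P * M) *\<^sub>v v)"
    using positive_form_coercive[OF PM] neg PMv by (metis neg_0_less_iff_less)
  define w where "w t = P *\<^sub>v h t" for t
  have w: "w t \<in> carrier_vec n" if "t \<ge> 0" for t using Pc h that by (simp add: w_def)
  have "tends_to_zero n w" unfolding w_def by (rule tends_to_zero_mult_mat_vec[OF h(2,1) Pc])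
  then have "((\<lambda>t. w t \<bullet> w t) \<longlongrightarrow> 0) at_top" by (rule tends_to_zero_scalar_prod_self[OF _ w])
  then have lim: "((\<lambda>t. 1 / (2 * c) * (w t \<bullet> w t)) \<longlongrightarrow> 0) at_top" by (rule tendsto_mult_right_zero)
  have diss: "f t \<bullet> (P *\<^sub>v (M *\<^sub>v f t + h t)) \<le> - (c / 2) * (f t \<bullet> f t) + 1 / (2 * c) * (w t \<bullet> w t)"
    if t: "t \<ge> 0" for t
  proof -
    note ft = f[OF t] and wt = w[OF t]
    have "f t \<bullet> (P *\<^sub>v (M *\<^sub>v f t + h t)) = f t \<bullet> (P *\<^sub>v (M *\<^sub>v f t)) + f t \<bullet> w t"
      using Pc M ft h(1)[OF t] by (simp add: w_def mult_add_distrib_mat_vec[of _ n n] scalar_prod_add_distrib[of _ n])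
    moreover have "f t \<bullet> (P *\<^sub>v (M *\<^sub>v f t)) \<le> - c * (f t \<bullet> f t)" using c(2)[OF ft] PMv[OF ft] by simp
    \<comment> \<open>Young's inequality, with the weight chosen so that exactly
      \<open>c / 2\<close> of the margin is spent.\<close>
    moreover have "0 \<le> (c \<cdot>\<^sub>v f t - w t) \<bullet> (c \<cdot>\<^sub>v f t - w t)" by (rule scalar_prod_self_nonneg)
    then have "2 * c * (f t \<bullet> w t) \<le> c * c * (f t \<bullet> f t) + w t \<bullet> w t"
      using ft wt by (simp add: minus_scalar_prod_distrib[of _ n] scalar_prod_minus_distrib[of _ n]
          comm_scalar_prod[of "w t" n "f t"] algebra_simps)
    then have "f t \<bullet> w t \<le> c / 2 * (f t \<bullet> f t) + 1 / (2 * c) * (w t \<bullet> w t)"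
      using c(1) by (simp add: field_simps)
    ultimately show ?thesis by (simp add: algebra_simps)
  qed
  \<comment> \<open>The single trajectory is presented as a family over \<open>{0}\<close>.\<close>
  have "tends_to_zero n ((\<lambda>_. f) (0::nat))"
  proof (rule lyapunov_family_tends_to_zero[OF sw _ P, of "{0}" _ "\<lambda>_ t. M *\<^sub>v f t + h t" "c / 2" "\<lambda>t. 1 / (2 * c) * (w t \<bullet> w t)"])
    show "M *\<^sub>v f t + h t \<in> carrier_vec n" if "t \<ge> 0" for t using M h f that by simp
  qed (use sol c lim diss in auto)
  then show ?thesis by simp
qed

subsection \<open>The leader observer\<close>

lemma H_mat_carrier: "H_mat N a \<in> carrier_mat N N"
  by (simp add: H_mat_def laplacian_def mat_delete_def)

lemma index_H_mat:
  assumes "i < N" "j < N"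
  shows "H_mat N a $$ (i, j) =
    (if i = j then (\<Sum>k\<in>{0..N} - {Suc i}. a (Suc i) k) else - a (Suc i) (Suc j))"
  using assms by (simp add: H_mat_def laplacian_def mat_delete_def)

text \<open>Row \<open>i\<close> belongs to node \<open>Suc i\<close>. Extending the vector by the
  value \<open>0\<close> at the leader restores the deleted column, so the product is again a sum of
  weighted differences over all nodes.\<close>

lemma H_mat_mult_vec:
  assumes v0: "v 0 = 0" and i: "i < N"
  shows "(H_mat N a *\<^sub>v vec N (\<lambda>k. v (Suc k))) $ i = (\<Sum>j\<in>{0..N}. a (Suc i) j * (v (Suc i) - v j))"
proof -
  let ?b = "a (Suc i)"
  have split: "{0..N} - {Suc i} = insert 0 (Suc ` ({0..<N} - {i}))"
  proof -
    have "Suc ` ({0..<N} - {i}) = Suc ` {0..<N} - {Suc i}"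
      using image_set_diff[of Suc "{0..<N}" "{i}"] by simp
    moreover have "{0..N} = insert 0 (Suc ` {0..<N})" by (auto simp: image_Suc_atLeastLessThan)
    ultimately show ?thesis by blast
  qed
  have "(H_mat N a *\<^sub>v vec N (\<lambda>k. v (Suc k))) $ i = (\<Sum>j\<in>{0..<N}. H_mat N a $$ (i, j) * v (Suc j))"
    using i H_mat_carrier[of N a] by (simp add: scalar_prod_def)
  also have "\<dots> = H_mat N a $$ (i, i) * v (Suc i) + (\<Sum>j\<in>{0..<N} - {i}. H_mat N a $$ (i, j) * v (Suc j))"
    using i by (simp add: sum.remove[of _ i])
  also have "\<dots> = (\<Sum>k\<in>{0..N} - {Suc i}. ?b k) * v (Suc i) - (\<Sum>j\<in>{0..<N} - {i}. ?b (Suc j) * v (Suc j))"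
    using i by (simp add: index_H_mat sum_negf)
  also have "(\<Sum>j\<in>{0..<N} - {i}. ?b (Suc j) * v (Suc j)) = (\<Sum>k\<in>{0..N} - {Suc i}. ?b k * v k)"
    unfolding split using v0 by (subst sum.insert) (auto simp: sum.reindex)
  also have "(\<Sum>k\<in>{0..N} - {Suc i}. ?b k) * v (Suc i) - \<dots> = (\<Sum>k\<in>{0..N} - {Suc i}. ?b k * (v (Suc i) - v k))"
    by (simp only: right_diff_distrib sum_subtractf sum_distrib_right)
  also have "\<dots> = (\<Sum>k\<in>{0..N}. ?b k * (v (Suc i) - v k))"
    using i by (simp add: sum.remove[of "{0..N}" "Suc i"])
  finally show ?thesis .
qed

lemma H_mat_quadratic_form:
  assumes "v 0 = 0"
  shows "vec N (\<lambda>k. v (Suc k)) \<bullet> (H_mat N a *\<^sub>v vec N (\<lambda>k. v (Suc k)))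
    = (\<Sum>i\<in>{1..N}. v i * (\<Sum>j\<in>{0..N}. a i j * (v i - v j)))"
proof -
  have "vec N (\<lambda>k. v (Suc k)) \<bullet> (H_mat N a *\<^sub>v vec N (\<lambda>k. v (Suc k)))
      = (\<Sum>i\<in>{0..<N}. v (Suc i) * (\<Sum>j\<in>{0..N}. a (Suc i) j * (v (Suc i) - v j)))"
    unfolding scalar_prod_def using H_mat_carrier[of N a]
    by (intro sum.cong) (auto simp: H_mat_mult_vec[of v, OF assms] simp del: index_mult_mat_vec)
  then show ?thesis by (simp add: sum.atLeast1_atMost_eq atLeast0LessThan)
qed

text \<open>Among followers the weights are symmetric, so the double sum \<open>X\<close> equals
  itself with both indices exchanged, and averaging the two produces squares. Edges from the leader
  are one-sided and contribute \<open>a i 0 * (v i)\<^sup>2\<close> directly.\<close>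

lemma laplacian_form_sum_of_squares:
  fixes v :: "nat \<Rightarrow> real"
  assumes "leader_connected N a" "v 0 = 0"
  shows "(\<Sum>i\<in>{1..N}. v i * (\<Sum>j\<in>{0..N}. a i j * (v i - v j)))
    = (\<Sum>i\<in>{1..N}. a i 0 * (v i)\<^sup>2) + (\<Sum>i\<in>{1..N}. \<Sum>j\<in>{1..N}. a i j * (v i - v j)\<^sup>2) / 2"
proof -
  have sym: "a i j = a j i" if "i \<in> {1..N}" "j \<in> {1..N}" for i j
    using assms(1) that by (simp add: leader_connected_def)
  define X where "X = (\<Sum>i\<in>{1..N}. \<Sum>j\<in>{1..N}. a i j * (v i * (v i - v j)))"
  have "X = (\<Sum>j\<in>{1..N}. \<Sum>i\<in>{1..N}. a i j * (v i * (v i - v j)))" unfolding X_def by (rule sum.swap)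
  also have "\<dots> = (\<Sum>i\<in>{1..N}. \<Sum>j\<in>{1..N}. a i j * (v j * (v j - v i)))"
    by (intro sum.cong refl) (simp add: sym)
  finally have XY: "X = \<dots>" .
  have "X + (\<Sum>i\<in>{1..N}. \<Sum>j\<in>{1..N}. a i j * (v j * (v j - v i)))
      = (\<Sum>i\<in>{1..N}. \<Sum>j\<in>{1..N}. a i j * (v i - v j)\<^sup>2)"
    unfolding X_def sum.distrib[symmetric]
    by (intro sum.cong refl) (simp add: power2_eq_square algebra_simps)
  then have "X + X = (\<Sum>i\<in>{1..N}. \<Sum>j\<in>{1..N}. a i j * (v i - v j)\<^sup>2)"
    by (simp only: XY[symmetric])
  moreover have "(\<Sum>i\<in>{1..N}. v i * (\<Sum>j\<in>{0..N}. a i j * (v i - v j))) = (\<Sum>i\<in>{1..N}. a i 0 * (v i)\<^sup>2) + X"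
    unfolding X_def sum.distrib[symmetric]
  proof (intro sum.cong refl)
    fix i
    have "{0..N} = insert 0 {1..N}" by auto
    then have "(\<Sum>j\<in>{0..N}. a i j * (v i - v j)) = a i 0 * v i + (\<Sum>j\<in>{1..N}. a i j * (v i - v j))"
      using assms(2) by simp
    then show "v i * (\<Sum>j\<in>{0..N}. a i j * (v i - v j))
        = a i 0 * (v i)\<^sup>2 + (\<Sum>j\<in>{1..N}. a i j * (v i * (v i - v j)))"
      by (simp add: distrib_left sum_distrib_left power2_eq_square mult_ac)
  qed
  ultimately show ?thesis by simp
qed

text \<open>If the form is not positive, every square in it vanishes. The node values then agree
  along each edge, and a path from the leader forces all of them to be \<open>0\<close>.\<close>

lemma H_mat_pos_def:
  assumes g: "leader_digraph N a" and c: "leader_connected N a"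
  shows "pos_def_mat N (H_mat N a)"
proof -
  have "transpose_mat (H_mat N a) = H_mat N a"
    using H_mat_carrier[of N a] c by (intro eq_matI) (auto simp: index_H_mat leader_connected_def)
  moreover have "w \<bullet> (H_mat N a *\<^sub>v w) > 0" if w: "w \<in> carrier_vec N" "w \<noteq> 0\<^sub>v N" for w
  proof (rule ccontr)
    \<comment> \<open>The index shift undoes the deletion of node \<open>0\<close>, where the value
      is set to \<open>0\<close>.\<close>
    define v where "v i = (if i = 0 then 0 else w $ (i - 1))" for i
    have v0: "v 0 = 0" by (simp add: v_def)
    have wv: "w = vec N (\<lambda>k. v (Suc k))" using w by (auto simp: v_def)
    have a0: "a i j \<ge> 0" if "i \<in> {0..N}" "j \<in> {0..N}" for i j using g that by (simp add: leader_digraph_def)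
    assume "\<not> w \<bullet> (H_mat N a *\<^sub>v w) > 0"
    then have le: "(\<Sum>i\<in>{1..N}. a i 0 * (v i)\<^sup>2) + (\<Sum>i\<in>{1..N}. \<Sum>j\<in>{1..N}. a i j * (v i - v j)\<^sup>2) / 2 \<le> 0"
      using H_mat_quadratic_form[of v, OF v0, of N a] laplacian_form_sum_of_squares[of N a v, OF c v0] by (simp add: wv[symmetric])
    have p1: "(\<Sum>i\<in>{1..N}. a i 0 * (v i)\<^sup>2) \<ge> 0" using a0 by (intro sum_nonneg) auto
    have p2: "(\<Sum>j\<in>{1..N}. a i j * (v i - v j)\<^sup>2) \<ge> 0" if "i \<in> {1..N}" for i
      using a0 that by (intro sum_nonneg) auto
    have p3: "(\<Sum>i\<in>{1..N}. \<Sum>j\<in>{1..N}. a i j * (v i - v j)\<^sup>2) \<ge> 0" by (intro sum_nonneg[OF p2])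
    have z1: "a i 0 * (v i)\<^sup>2 = 0" if "i \<in> {1..N}" for i
    proof -
      have "(\<Sum>i\<in>{1..N}. a i 0 * (v i)\<^sup>2) = 0" using le p1 p3 by simp
      then show ?thesis using a0 that by (subst (asm) sum_nonneg_eq_0_iff) auto
    qed
    have z2: "a i j * (v i - v j)\<^sup>2 = 0" if "i \<in> {1..N}" "j \<in> {1..N}" for i j
    proof -
      have "(\<Sum>i\<in>{1..N}. \<Sum>j\<in>{1..N}. a i j * (v i - v j)\<^sup>2) = 0" using le p1 p3 by simp
      then have "(\<Sum>j\<in>{1..N}. a i j * (v i - v j)\<^sup>2) = 0"
        using p2 that by (subst (asm) sum_nonneg_eq_0_iff) auto
      then show ?thesis using a0 that by (subst (asm) sum_nonneg_eq_0_iff) auto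
    qed
    have edge: "v i = v j" if "(j, i) \<in> edges N a" for i j
    proof -
      have ij: "i \<in> {0..N}" "j \<in> {0..N}" "a i j > 0" using that by (auto simp: edges_def)
      \<comment> \<open>No edge enters the leader, so the head of an edge is a follower and one of
        the vanishing terms applies to it.\<close>
      have "a 0 j = 0" using g ij(2) by (cases "j = 0") (auto simp: leader_digraph_def)
      then have "i \<noteq> 0" using ij(3) by (metis less_irrefl)
      then have i1: "i \<in> {1..N}" using ij(1) by auto
      show ?thesis
      proof (cases "j = 0")
        case True
        then show ?thesis using z1[OF i1] ij(3) v0 by simp
      next
        case False
        then show ?thesis using z2[OF i1, of j] ij by auto
      qed
    qed
    have "v i = 0" if "(0, i) \<in> (edges N a)\<^sup>*" for i
      using that by (induction rule: rtrancl_induct) (auto simp: v0 dest: edge)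
    then have "v (Suc k) = 0" if "k < N" for k
      using c that by (auto simp: leader_connected_def)
    then have "w = 0\<^sub>v N" unfolding wv by auto
    then show False using w by simp
  qed
  ultimately show ?thesis using H_mat_carrier by (simp add: pos_def_mat_def)
qed

text \<open>\<open>Min\<close> is informative only on a finite nonempty set. The eigenvalues are
  roots of finitely many nonzero polynomials, and each graph contributes at least its least
  eigenvalue, which also bounds its form from below.\<close>

lemma lambda_bar:
  assumes N: "N \<ge> 1" and \<kappa>: "\<kappa> \<ge> 1"
    and graphs: "\<And>p. p \<in> {1..\<kappa>} \<Longrightarrow> leader_digraph N (a p)"
    and connected: "\<And>p. p \<in> {1..\<kappa>} \<Longrightarrow> leader_connected N (a p)"
  shows lambda_bar_pos: "lambda_bar N \<kappa> a > 0"
    and lambda_bar_le: "\<And>p (v :: real vec). p \<in> {1..\<kappa>} \<Longrightarrow> v \<in> carrier_vec N \<Longrightarrow>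
      lambda_bar N \<kappa> a * (v \<bullet> v) \<le> v \<bullet> (H_mat N (a p) *\<^sub>v v)"
proof -
  define Y where "Y = {ev. \<exists>p\<in>{1..\<kappa>}. eigenvalue (H_mat N (a p)) ev}"
  have pd: "pos_def_mat N (H_mat N (a p))" if "p \<in> {1..\<kappa>}" for p
    using H_mat_pos_def graphs connected that by blast
  have "finite {ev. eigenvalue (H_mat N (a p)) ev}" for p
  proof -
    have "char_poly (H_mat N (a p)) \<noteq> 0"
      using degree_monic_char_poly[OF H_mat_carrier, of N "a p"] by auto
    then show ?thesis
      using poly_roots_finite by (simp add: eigenvalue_root_char_poly[OF H_mat_carrier])
  qed
  moreover have "Y = (\<Union>p\<in>{1..\<kappa>}. {ev. eigenvalue (H_mat N (a p)) ev})" by (auto simp: Y_def)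
  ultimately have fin: "finite Y" by simp
  have min: "\<exists>m\<in>Y. \<forall>v\<in>carrier_vec N. m * (v \<bullet> v) \<le> v \<bullet> (H_mat N (a p) *\<^sub>v v)" if p: "p \<in> {1..\<kappa>}" for p
  proof -
    have "transpose_mat (H_mat N (a p)) = H_mat N (a p)" "N > 0" using pd[OF p] N by (auto simp: pos_def_mat_def)
    then obtain m where m: "eigenvalue (H_mat N (a p)) m"
      "\<And>v. v \<in> carrier_vec N \<Longrightarrow> m * (v \<bullet> v) \<le> v \<bullet> (H_mat N (a p) *\<^sub>v v)"
      using symmetric_min_eigenvalue[OF H_mat_carrier, of N "a p"] by metis
    from m(1) p have "m \<in> Y" by (auto simp: Y_def)
    with m(2) show ?thesis by blast
  qed
  have lb: "lambda_bar N \<kappa> a = Min Y" by (simp add: lambda_bar_def Y_def)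
  have ne: "Y \<noteq> {}" using min[of 1] \<kappa> by auto
  show "lambda_bar N \<kappa> a > 0"
  proof -
    have "lambda_bar N \<kappa> a \<in> Y" unfolding lb using fin ne by (rule Min_in)
    then obtain p v where p: "p \<in> {1..\<kappa>}" and v: "v \<in> carrier_vec N" "v \<noteq> 0\<^sub>v N"
      "H_mat N (a p) *\<^sub>v v = lambda_bar N \<kappa> a \<cdot>\<^sub>v v"
      using H_mat_carrier[of N] by (auto simp: Y_def eigenvalue_def eigenvector_def carrier_matD[OF H_mat_carrier])
    have "v \<bullet> (H_mat N (a p) *\<^sub>v v) > 0" using pd[OF p] v(1,2) by (simp add: pos_def_mat_def)
    then have "lambda_bar N \<kappa> a * (v \<bullet> v) > 0" using v by simp
    then show ?thesis using scalar_prod_self_pos[OF v(1,2)] by (rule zero_less_mult_pos2)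
  qed
  fix p and v :: "real vec" assume p: "p \<in> {1..\<kappa>}" and v: "v \<in> carrier_vec N"
  obtain m where m: "m \<in> Y" "m * (v \<bullet> v) \<le> v \<bullet> (H_mat N (a p) *\<^sub>v v)" using min[OF p] v by blast
  have "lambda_bar N \<kappa> a * (v \<bullet> v) \<le> m * (v \<bullet> v)"
    unfolding lb using fin m(1) scalar_prod_self_nonneg[of v] by (intro mult_right_mono) auto
  then show "lambda_bar N \<kappa> a * (v \<bullet> v) \<le> v \<bullet> (H_mat N (a p) *\<^sub>v v)" using m(2) by simp
qed

section \<open>Relative measurements and the error of the leader observer\<close>

lemma relative_sum_carrier:
  assumes "\<And>j. j \<in> {0..N} \<Longrightarrow> \<eta> j \<in> carrier_vec n" "i \<in> {0..N}"
  shows "relative_sum n N a \<eta> i \<in> carrier_vec n"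
  unfolding relative_sum_def using assms by (intro finsum_vec_closed) auto

text \<open>After multiplication by the output matrix, each output coordinate is a scalar signal on
  the nodes to which the Laplacian applies. This takes the place of Kronecker products.\<close>

lemma index_mult_relative_sum:
  assumes A: "A \<in> carrier_mat l n" and \<eta>: "\<And>j. j \<in> {0..N} \<Longrightarrow> \<eta> j \<in> carrier_vec n"
    and i: "i \<in> {0..N}" and c: "c < l"
  shows "(A *\<^sub>v relative_sum n N a \<eta> i) $ c = (\<Sum>j\<in>{0..N}. a i j * ((A *\<^sub>v \<eta> i) $ c - (A *\<^sub>v \<eta> j) $ c))"
proof -
  have rs: "relative_sum n N a \<eta> i \<in> carrier_vec n"
    by (rule relative_sum_carrier[OF \<eta> i])
  have rsc: "relative_sum n N a \<eta> i $ d = (\<Sum>j\<in>{0..N}. a i j * (\<eta> i $ d - \<eta> j $ d))" if d: "d < n" for d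
  proof -
    have "relative_sum n N a \<eta> i $ d = (\<Sum>j\<in>{0..N}. (a i j \<cdot>\<^sub>v (\<eta> i - \<eta> j)) $ d)"
      unfolding relative_sum_def using \<eta> i d by (intro index_finsum_vec) auto
    also have "\<dots> = (\<Sum>j\<in>{0..N}. a i j * (\<eta> i $ d - \<eta> j $ d))"
      using carrier_vecD[OF \<eta>] d by (intro sum.cong refl) simp
    finally show ?thesis .
  qed
  have e: "(A *\<^sub>v v) $ c = (\<Sum>d\<in>{0..<n}. A $$ (c, d) * v $ d)" if "v \<in> carrier_vec n" for v
    using A c that by (auto simp: scalar_prod_def)
  have "(A *\<^sub>v relative_sum n N a \<eta> i) $ c
      = (\<Sum>d\<in>{0..<n}. \<Sum>j\<in>{0..N}. a i j * (A $$ (c, d) * \<eta> i $ d - A $$ (c, d) * \<eta> j $ d))"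
    unfolding e[OF rs] by (intro sum.cong refl) (simp add: rsc sum_distrib_left algebra_simps)
  also have "\<dots> = (\<Sum>j\<in>{0..N}. \<Sum>d\<in>{0..<n}. a i j * (A $$ (c, d) * \<eta> i $ d - A $$ (c, d) * \<eta> j $ d))"
    by (rule sum.swap)
  also have "\<dots> = (\<Sum>j\<in>{0..N}. a i j * ((A *\<^sub>v \<eta> i) $ c - (A *\<^sub>v \<eta> j) $ c))"
    using e \<eta> i by (intro sum.cong refl) (simp add: right_diff_distrib sum_distrib_left sum_subtractf)
  finally show ?thesis .
qed

lemma vec_add_minus_swap:
  fixes x y w :: "'a :: ab_group_add vec"
  assumes "x \<in> carrier_vec n" "w \<in> carrier_vec n" "y \<in> carrier_vec n"
  shows "(x + y) - w = (x - w) + y"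
  using assms by (intro eq_vecI) auto

text \<open>Half the derivative of the total energy is \<open>\<Sum> e \<bullet> P S e\<close> minus
  \<open>\<mu>\<close> times the coupling between the outputs \<open>F e\<close>. The coupling is at
  least \<open>lambda_bar\<close> times their squared lengths, so half the form of the matrix in
  \<open>P_ineq\<close> bounds the whole from above.\<close>

lemma leader_observer_converges:
  assumes N: "N \<ge> 1" and sw: "switching_signal \<kappa> \<tau> ts \<sigma>"
    and graphs: "\<And>p. p \<in> {1..\<kappa>} \<Longrightarrow> leader_digraph N (a p)"
    and connected: "\<And>p. p \<in> {1..\<kappa>} \<Longrightarrow> leader_connected N (a p)"
    and S: "S \<in> carrier_mat n n" and F: "F \<in> carrier_mat l n"
    and P: "pos_def_mat n P"
    and P_ineq: "neg_def_mat n (P * S + transpose_mat S * P - 2 \<cdot>\<^sub>m (transpose_mat F * F))"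
    and L: "L = (- mu_star N \<kappa> a) \<cdot>\<^sub>m (the (mat_inverse P) * transpose_mat F)"
    and r: "solves_ode ts n r (\<lambda>t. S *\<^sub>v r t)" and \<eta>0: "\<And>t. t \<ge> 0 \<Longrightarrow> \<eta> 0 t = r t"
    and \<eta>: "\<And>i. i \<in> {1..N} \<Longrightarrow> solves_ode ts n (\<eta> i)
      (\<lambda>t. S *\<^sub>v \<eta> i t + (L * F) *\<^sub>v relative_sum n N (a (\<sigma> t)) (\<lambda>j. \<eta> j t) i)"
    and i: "i \<in> {1..N}"
  shows "tends_to_zero n (\<lambda>t. \<eta> i t - r t)"
proof -
  define \<mu> where "\<mu> = mu_star N \<kappa> a"
  have Pc: "P \<in> carrier_mat n n" using P by (simp add: pos_def_mat_def)
  note inv = pos_def_mat_inverse[OF P]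
  have Lc: "L \<in> carrier_mat n l" using inv F by (simp add: L)
  have \<sigma>: "\<sigma> t \<in> {1..\<kappa>}" if "t \<ge> 0" for t using sw that by (simp add: switching_signal_def)
  \<comment> \<open>The value at time \<open>0\<close> exhibits a graph, so that
    \<open>lambda_bar\<close> is a minimum over a nonempty set.\<close>
  have "\<sigma> 0 \<in> {1..\<kappa>}" by (rule \<sigma>) simp
  then have \<kappa>: "\<kappa> \<ge> 1" by auto
  have lpos: "lambda_bar N \<kappa> a > 0" by (rule lambda_bar_pos[OF N \<kappa> graphs connected])
  have lle: "lambda_bar N \<kappa> a * (v \<bullet> v) \<le> v \<bullet> (H_mat N (a p) *\<^sub>v v)"
    if "p \<in> {1..\<kappa>}" "v \<in> carrier_vec N" for p v
    by (rule lambda_bar_le[OF N \<kappa> graphs connected that])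
  have \<mu>: "\<mu> \<ge> 1" "\<mu> * lambda_bar N \<kappa> a \<ge> 1"
    using lpos by (auto simp: \<mu>_def mu_star_def max_def field_simps)
  have rc: "r t \<in> carrier_vec n" if "t \<ge> 0" for t using solves_ode_carrier[OF r that] .
  have \<eta>c: "\<eta> j t \<in> carrier_vec n" if "j \<in> {0..N}" "t \<ge> 0" for j t
  proof (cases "j = 0")
    case True
    then show ?thesis using \<eta>0 rc that by simp
  next
    case False
    then have "j \<in> {1..N}" using that by simp
    from solves_ode_carrier[OF \<eta>[OF this] that(2)] show ?thesis .
  qed
  define z where "z i t = relative_sum n N (a (\<sigma> t)) (\<lambda>j. \<eta> j t) i" for i t
  have zc: "z i t \<in> carrier_vec n" if "i \<in> {0..N}" "t \<ge> 0" for i t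
    unfolding z_def by (rule relative_sum_carrier) (use \<eta>c that in auto)
  define e where "e i t = \<eta> i t - r t" for i t
  have ec: "e i t \<in> carrier_vec n" if "i \<in> {0..N}" "t \<ge> 0" for i t
    using \<eta>c rc that by (simp add: e_def)
  define g where "g i t = S *\<^sub>v e i t + (L * F) *\<^sub>v z i t" for i t
  have gc: "g i t \<in> carrier_vec n" if "i \<in> {0..N}" "t \<ge> 0" for i t
    using S Lc F ec zc that by (simp add: g_def)
  have sol: "solves_ode ts n (e i) (g i)" if i: "i \<in> {1..N}" for i
  proof -
    have "solves_ode ts n (\<lambda>t. \<eta> i t - r t) (\<lambda>t. (S *\<^sub>v \<eta> i t + (L * F) *\<^sub>v z i t) - S *\<^sub>v r t)"
      unfolding z_def using S rc by (intro solves_ode_minus[OF sw \<eta>[OF i] r]) auto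
    then have "solves_ode ts n (\<lambda>t. \<eta> i t - r t) (g i)"
    proof (rule solves_ode_cong[OF sw])
      fix t :: real assume t: "t \<ge> 0"
      then have "S *\<^sub>v e i t = S *\<^sub>v \<eta> i t - S *\<^sub>v r t"
        using S \<eta>c rc i by (simp add: e_def mult_minus_distrib_mat_vec[of _ n n])
      moreover have "S *\<^sub>v \<eta> i t \<in> carrier_vec n" "S *\<^sub>v r t \<in> carrier_vec n" "(L * F) *\<^sub>v z i t \<in> carrier_vec n"
        using S Lc F \<eta>c rc zc i t by auto
      ultimately show "(S *\<^sub>v \<eta> i t + (L * F) *\<^sub>v z i t) - S *\<^sub>v r t = g i t"
        unfolding g_def by (simp only: vec_add_minus_swap)
    qed
    then show ?thesis by (simp add: e_def[abs_def])
  qed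
  define Q where "Q = P * S + transpose_mat S * P - 2 \<cdot>\<^sub>m (transpose_mat F * F)"
  have Qc: "Q \<in> carrier_mat n n" "- Q \<in> carrier_mat n n" using P_ineq by (auto simp: Q_def[symmetric] neg_def_mat_def)
  have Qv: "v \<bullet> (Q *\<^sub>v v) = 2 * (v \<bullet> (P *\<^sub>v (S *\<^sub>v v))) - 2 * ((F *\<^sub>v v) \<bullet> (F *\<^sub>v v))"
    if v: "v \<in> carrier_vec n" for v
  proof -
    have Ft: "transpose_mat F \<in> carrier_mat n l" and St: "transpose_mat S \<in> carrier_mat n n" using F S by auto
    have "Q *\<^sub>v v = (P *\<^sub>v (S *\<^sub>v v) + transpose_mat S *\<^sub>v (P *\<^sub>v v)) - 2 \<cdot>\<^sub>v (transpose_mat F *\<^sub>v (F *\<^sub>v v))"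
    proof -
      have "Q *\<^sub>v v = (P * S + transpose_mat S * P) *\<^sub>v v - (2 \<cdot>\<^sub>m (transpose_mat F * F)) *\<^sub>v v"
        unfolding Q_def using Pc S St Ft F v by (intro minus_mult_distrib_mat_vec) auto
      moreover have "(P * S + transpose_mat S * P) *\<^sub>v v = (P * S) *\<^sub>v v + (transpose_mat S * P) *\<^sub>v v"
        using Pc S St v by (intro add_mult_distrib_mat_vec) auto
      moreover have "(2 \<cdot>\<^sub>m (transpose_mat F * F)) *\<^sub>v v = 2 \<cdot>\<^sub>v ((transpose_mat F * F) *\<^sub>v v)"
        using F v by (intro smult_mat_mult_mat_vec) auto
      ultimately show ?thesis
        using assoc_mult_mat_vec[OF Pc S v] assoc_mult_mat_vec[OF St Pc v] assoc_mult_mat_vec[OF Ft F v] by simp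
    qed
    moreover have "v \<bullet> (transpose_mat S *\<^sub>v (P *\<^sub>v v)) = v \<bullet> (P *\<^sub>v (S *\<^sub>v v))"
      using scalar_prod_mult_mat_vec_transpose[OF S _ v, of "P *\<^sub>v v"] Pc S v P
        comm_scalar_prod[of "P *\<^sub>v v" n "S *\<^sub>v v"] symmetric_scalar_prod[OF Pc _ v, of "S *\<^sub>v v"]
      by (simp add: pos_def_mat_def)
    moreover have "v \<bullet> (transpose_mat F *\<^sub>v (F *\<^sub>v v)) = (F *\<^sub>v v) \<bullet> (F *\<^sub>v v)"
      using scalar_prod_mult_mat_vec_transpose[OF F _ v, of "F *\<^sub>v v"] F v by simp
    ultimately show ?thesis using v Pc S F
      by (simp add: scalar_prod_minus_distrib[of _ n] scalar_prod_add_distrib[of _ n])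
  qed
  have "v \<bullet> (- Q *\<^sub>v v) > 0" if "v \<in> carrier_vec n" "v \<noteq> 0\<^sub>v n" for v
    using P_ineq that Qc unfolding Q_def[symmetric] neg_def_mat_def by simp
  then obtain c where c: "c > 0" "\<And>v. v \<in> carrier_vec n \<Longrightarrow> c * (v \<bullet> v) \<le> v \<bullet> (- Q *\<^sub>v v)"
    using positive_form_coercive[OF Qc(2)] by blast
  \<comment> \<open>Here the form of the gain pays off: \<open>P\<close> cancels its inverse, and
    the coupling acts through \<open>F\<close> on both sides of the scalar product.\<close>
  have PLF: "P *\<^sub>v ((L * F) *\<^sub>v v) = (- \<mu>) \<cdot>\<^sub>v (transpose_mat F *\<^sub>v (F *\<^sub>v v))" if v: "v \<in> carrier_vec n" for v
  proof -
    let ?R = "the (mat_inverse P)"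
    have Ft: "transpose_mat F \<in> carrier_mat n l" using F by simp
    have Fv: "F *\<^sub>v v \<in> carrier_vec l" and FFv: "transpose_mat F *\<^sub>v (F *\<^sub>v v) \<in> carrier_vec n" using F v by auto
    have "(L * F) *\<^sub>v v = L *\<^sub>v (F *\<^sub>v v)" by (rule assoc_mult_mat_vec[OF Lc F v])
    also have "\<dots> = (- \<mu>) \<cdot>\<^sub>v ((?R * transpose_mat F) *\<^sub>v (F *\<^sub>v v))"
      unfolding L \<mu>_def using inv(1) Ft Fv by (intro smult_mat_mult_mat_vec) auto
    also have "(?R * transpose_mat F) *\<^sub>v (F *\<^sub>v v) = ?R *\<^sub>v (transpose_mat F *\<^sub>v (F *\<^sub>v v))"
      by (rule assoc_mult_mat_vec[OF inv(1) Ft Fv])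
    finally have "P *\<^sub>v ((L * F) *\<^sub>v v) = (- \<mu>) \<cdot>\<^sub>v (P *\<^sub>v (?R *\<^sub>v (transpose_mat F *\<^sub>v (F *\<^sub>v v))))"
      using mult_mat_vec[OF Pc, of "?R *\<^sub>v (transpose_mat F *\<^sub>v (F *\<^sub>v v))" "- \<mu>"] inv(1) FFv by simp
    also have "P *\<^sub>v (?R *\<^sub>v (transpose_mat F *\<^sub>v (F *\<^sub>v v))) = transpose_mat F *\<^sub>v (F *\<^sub>v v)"
      using assoc_mult_mat_vec[OF Pc inv(1) FFv] inv(2) FFv by simp
    finally show ?thesis .
  qed
  \<comment> \<open>The \<open>+ 0\<close> is the vanishing input term expected by
    \<open>lyapunov_family_tends_to_zero\<close>.\<close>
  have diss: "(\<Sum>i\<in>{1..N}. e i t \<bullet> (P *\<^sub>v g i t)) \<le> - (c / 2) * (\<Sum>i\<in>{1..N}. e i t \<bullet> e i t) + 0"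
    if t: "t \<ge> 0" for t
  proof -
    define \<phi> where "\<phi> i = F *\<^sub>v e i t" for i
    have \<phi>c: "\<phi> i \<in> carrier_vec l" if "i \<in> {0..N}" for i using F ec[OF that t] by (simp add: \<phi>_def)
    \<comment> \<open>The leader has no error with respect to itself. This is the zero value at node
      \<open>0\<close> on which the Laplacian lemmas rest.\<close>
    have "e 0 t = 0\<^sub>v n" using \<eta>0[OF t] rc[OF t] by (simp add: e_def)
    then have \<phi>0: "\<phi> 0 $ k = 0" if "k < l" for k using F that by (simp add: \<phi>_def scalar_prod_def)
    have summand: "e i t \<bullet> (P *\<^sub>v g i t) = e i t \<bullet> (P *\<^sub>v (S *\<^sub>v e i t)) - \<mu> * (\<phi> i \<bullet> (F *\<^sub>v z i t))"
      if i: "i \<in> {1..N}" for i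
    proof -
      have et: "e i t \<in> carrier_vec n" and zt: "z i t \<in> carrier_vec n" using ec zc t i by auto
      have "P *\<^sub>v g i t = P *\<^sub>v (S *\<^sub>v e i t) + P *\<^sub>v ((L * F) *\<^sub>v z i t)"
        unfolding g_def using Pc S Lc F et zt by (intro mult_add_distrib_mat_vec) auto
      moreover have "e i t \<bullet> (transpose_mat F *\<^sub>v (F *\<^sub>v z i t)) = \<phi> i \<bullet> (F *\<^sub>v z i t)"
        using scalar_prod_mult_mat_vec_transpose[OF F _ et, of "F *\<^sub>v z i t"] F zt et
          comm_scalar_prod[of "F *\<^sub>v z i t" l "\<phi> i"] by (simp add: \<phi>_def)
      ultimately show ?thesis using Pc S F et zt
        by (simp add: PLF scalar_prod_add_distrib[of _ n])
    qed
    have "lambda_bar N \<kappa> a * (\<Sum>i\<in>{1..N}. \<phi> i \<bullet> \<phi> i) = (\<Sum>k\<in>{0..<l}. lambda_bar N \<kappa> a * (\<Sum>i\<in>{1..N}. \<phi> i $ k * \<phi> i $ k))"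
    proof -
      have "(\<Sum>i\<in>{1..N}. \<phi> i \<bullet> \<phi> i) = (\<Sum>i\<in>{1..N}. \<Sum>k\<in>{0..<l}. \<phi> i $ k * \<phi> i $ k)"
        using carrier_vecD[OF \<phi>c] by (intro sum.cong refl) (simp add: scalar_prod_def)
      also have "\<dots> = (\<Sum>k\<in>{0..<l}. \<Sum>i\<in>{1..N}. \<phi> i $ k * \<phi> i $ k)" by (rule sum.swap)
      finally show ?thesis by (simp add: sum_distrib_left)
    qed
    also have "\<dots> \<le> (\<Sum>k\<in>{0..<l}. \<Sum>i\<in>{1..N}. \<phi> i $ k * (\<Sum>j\<in>{0..N}. a (\<sigma> t) i j * (\<phi> i $ k - \<phi> j $ k)))"
    proof (rule sum_mono)
      fix k assume "k \<in> {0..<l}"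
      then have v0: "\<phi> 0 $ k = 0" using \<phi>0 by simp
      let ?v = "vec N (\<lambda>j. \<phi> (Suc j) $ k)"
      have "lambda_bar N \<kappa> a * (?v \<bullet> ?v) \<le> ?v \<bullet> (H_mat N (a (\<sigma> t)) *\<^sub>v ?v)"
        using lle[OF \<sigma>[OF t]] by simp
      moreover have "?v \<bullet> ?v = (\<Sum>i\<in>{1..N}. \<phi> i $ k * \<phi> i $ k)"
        by (simp add: scalar_prod_def sum.atLeast1_atMost_eq atLeast0LessThan)
      ultimately show "lambda_bar N \<kappa> a * (\<Sum>i\<in>{1..N}. \<phi> i $ k * \<phi> i $ k)
          \<le> (\<Sum>i\<in>{1..N}. \<phi> i $ k * (\<Sum>j\<in>{0..N}. a (\<sigma> t) i j * (\<phi> i $ k - \<phi> j $ k)))"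
        using H_mat_quadratic_form[of "\<lambda>i. \<phi> i $ k", OF v0] by simp
    qed
    also have "\<dots> = (\<Sum>i\<in>{1..N}. \<phi> i \<bullet> (F *\<^sub>v z i t))"
    proof -
      have "(F *\<^sub>v z i t) $ k = (\<Sum>j\<in>{0..N}. a (\<sigma> t) i j * (\<phi> i $ k - \<phi> j $ k))"
        if i: "i \<in> {1..N}" and k: "k < l" for i k
      proof -
        \<comment> \<open>Only differences enter the relative sum, so the leader state cancels and
          observer states may be replaced by errors.\<close>
        have "\<phi> i $ k - \<phi> j $ k = (F *\<^sub>v \<eta> i t) $ k - (F *\<^sub>v \<eta> j t) $ k" if j: "j \<in> {0..N}" for j
        proof -
          have "\<phi> j' = F *\<^sub>v \<eta> j' t - F *\<^sub>v r t" if "j' \<in> {0..N}" for j'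
            using F \<eta>c[OF that t] rc[OF t] by (simp add: \<phi>_def e_def mult_minus_distrib_mat_vec[of _ l n])
          then show ?thesis using i j k F by (simp del: index_mult_mat_vec)
        qed
        moreover have "(F *\<^sub>v z i t) $ k = (\<Sum>j\<in>{0..N}. a (\<sigma> t) i j * ((F *\<^sub>v \<eta> i t) $ k - (F *\<^sub>v \<eta> j t) $ k))"
          unfolding z_def using \<eta>c[OF _ t] i k by (intro index_mult_relative_sum[OF F]) auto
        ultimately show ?thesis by simp
      qed
      then have "(\<Sum>i\<in>{1..N}. \<phi> i \<bullet> (F *\<^sub>v z i t)) = (\<Sum>i\<in>{1..N}. \<Sum>k\<in>{0..<l}. \<phi> i $ k *
          (\<Sum>j\<in>{0..N}. a (\<sigma> t) i j * (\<phi> i $ k - \<phi> j $ k)))"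
        using F by (intro sum.cong refl) (simp add: scalar_prod_def[of "\<phi> _"] del: index_mult_mat_vec)
      also have "\<dots> = (\<Sum>k\<in>{0..<l}. \<Sum>i\<in>{1..N}. \<phi> i $ k *
          (\<Sum>j\<in>{0..N}. a (\<sigma> t) i j * (\<phi> i $ k - \<phi> j $ k)))" by (rule sum.swap)
      finally show ?thesis by simp
    qed
    finally have "\<mu> * (lambda_bar N \<kappa> a * (\<Sum>i\<in>{1..N}. \<phi> i \<bullet> \<phi> i)) \<le> \<mu> * (\<Sum>i\<in>{1..N}. \<phi> i \<bullet> (F *\<^sub>v z i t))"
      using \<mu>(1) by (intro mult_left_mono) auto
    moreover have "(\<Sum>i\<in>{1..N}. \<phi> i \<bullet> \<phi> i) \<le> \<mu> * lambda_bar N \<kappa> a * (\<Sum>i\<in>{1..N}. \<phi> i \<bullet> \<phi> i)"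
      using mult_right_mono[OF \<mu>(2), of "\<Sum>i\<in>{1..N}. \<phi> i \<bullet> \<phi> i"]
      by (simp add: sum_nonneg scalar_prod_self_nonneg)
    ultimately have key: "(\<Sum>i\<in>{1..N}. \<phi> i \<bullet> \<phi> i) \<le> \<mu> * (\<Sum>i\<in>{1..N}. \<phi> i \<bullet> (F *\<^sub>v z i t))"
      by (simp add: mult.assoc)
    have "(\<Sum>i\<in>{1..N}. e i t \<bullet> (P *\<^sub>v g i t))
        = (\<Sum>i\<in>{1..N}. e i t \<bullet> (P *\<^sub>v (S *\<^sub>v e i t))) - \<mu> * (\<Sum>i\<in>{1..N}. \<phi> i \<bullet> (F *\<^sub>v z i t))"
      by (simp add: summand sum_subtractf sum_distrib_left)
    also have "\<dots> \<le> (\<Sum>i\<in>{1..N}. e i t \<bullet> (P *\<^sub>v (S *\<^sub>v e i t))) - (\<Sum>i\<in>{1..N}. \<phi> i \<bullet> \<phi> i)" using key by simp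
    also have "\<dots> = (\<Sum>i\<in>{1..N}. (e i t \<bullet> (Q *\<^sub>v e i t)) / 2)"
      unfolding sum_subtractf[symmetric]
    proof (rule sum.cong[OF refl])
      fix i assume "i \<in> {1..N}"
      then have "e i t \<in> carrier_vec n" using ec t by simp
      then show "e i t \<bullet> (P *\<^sub>v (S *\<^sub>v e i t)) - \<phi> i \<bullet> \<phi> i = (e i t \<bullet> (Q *\<^sub>v e i t)) / 2"
        unfolding \<phi>_def by (simp add: Qv diff_divide_distrib)
    qed
    also have "\<dots> \<le> (\<Sum>i\<in>{1..N}. - (c / 2) * (e i t \<bullet> e i t))"
    proof (rule sum_mono)
      fix i assume "i \<in> {1..N}"
      then have "e i t \<in> carrier_vec n" using ec t by simp
      from c(2)[OF this] show "(e i t \<bullet> (Q *\<^sub>v e i t)) / 2 \<le> - (c / 2) * (e i t \<bullet> e i t)"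
        using Qc \<open>e i t \<in> carrier_vec n\<close> by simp
    qed
    finally show ?thesis by (simp add: sum_distrib_left)
  qed
  have "tends_to_zero n (e i)"
  proof (rule lyapunov_family_tends_to_zero[OF sw _ P sol _ _ tendsto_const diss i])
    show "g j t \<in> carrier_vec n" if "j \<in> {1..N}" "t \<ge> 0" for j t using that by (intro gc) auto
    show "c / 2 > 0" using c(1) by simp
  qed simp_all
  then show ?thesis unfolding e_def .
qed

subsection \<open>Output regulation of a follower\<close>

text \<open>The gains must be fixed before any trajectory is known, hence the trajectories are
  quantified inside the conclusion. The graph enters only through the premise that
  \<open>\<eta> t - r t\<close> vanishes, so one follower can be treated alone.\<close>

lemma follower_gains:
  assumes A: "A \<in> carrier_mat n n" and B: "B \<in> carrier_mat n m" and C: "C \<in> carrier_mat l n"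
    and D: "D \<in> carrier_mat l m" and E: "E \<in> carrier_mat n q" and S: "S \<in> carrier_mat q q"
    and S\<^sub>0: "S\<^sub>0 \<in> carrier_mat n\<^sub>0 n\<^sub>0" and F: "F \<in> carrier_mat l n\<^sub>0"
    and stab: "stabilizable A B"
    and det: "detectable (block_row C (0\<^sub>m l q)) (four_block_mat A E (0\<^sub>m q n) S)"
    and X1: "X1 \<in> carrier_mat n q" and X2: "X2 \<in> carrier_mat n n\<^sub>0"
    and U1: "U1 \<in> carrier_mat m q" and U2: "U2 \<in> carrier_mat m n\<^sub>0"
    and reg1: "X1 * S = A * X1 + B * U1 + E" "0\<^sub>m l q = C * X1 + D * U1"
    and reg2: "X2 * S\<^sub>0 = A * X2 + B * U2" "0\<^sub>m l n\<^sub>0 = C * X2 + D * U2 - F"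
    and sw: "switching_signal \<kappa> \<tau> ts \<sigma>"
  obtains K1 K2 K3 L where "K1 \<in> carrier_mat m n" "K2 \<in> carrier_mat m q" "K3 \<in> carrier_mat m n\<^sub>0"
    "L \<in> carrier_mat q n"
    "\<And>x u d \<zeta> \<eta> r.
      solves_ode ts n\<^sub>0 r (\<lambda>t. S\<^sub>0 *\<^sub>v r t) \<Longrightarrow>
      solves_ode ts n x (\<lambda>t. A *\<^sub>v x t + B *\<^sub>v u t + E *\<^sub>v d t) \<Longrightarrow>
      solves_ode ts q d (\<lambda>t. S *\<^sub>v d t) \<Longrightarrow>
      solves_ode ts q \<zeta> (\<lambda>t. (S + L * E) *\<^sub>v \<zeta> t + (L * A - S * L - L * E * L) *\<^sub>v x t + (L * B) *\<^sub>v u t) \<Longrightarrow>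
      (\<And>t. t \<ge> 0 \<Longrightarrow> u t = K1 *\<^sub>v x t + K2 *\<^sub>v (\<zeta> t - L *\<^sub>v x t) + K3 *\<^sub>v \<eta> t) \<Longrightarrow>
      (\<And>t. t \<ge> 0 \<Longrightarrow> \<eta> t \<in> carrier_vec n\<^sub>0) \<Longrightarrow>
      tends_to_zero n\<^sub>0 (\<lambda>t. \<eta> t - r t) \<Longrightarrow>
      tends_to_zero l (\<lambda>t. C *\<^sub>v x t + D *\<^sub>v u t - F *\<^sub>v r t)"
proof -
  obtain K1 where K1: "K1 \<in> carrier_mat m n" and hur: "hurwitz (A + B * K1)"
    using stab A B unfolding stabilizable_def by auto
  have M: "A + B * K1 \<in> carrier_mat n n" using A B K1 by simp
  obtain R where R: "pos_def_mat n R"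
    "\<And>v. v \<in> carrier_vec n \<Longrightarrow> v \<noteq> 0\<^sub>v n \<Longrightarrow> v \<bullet> (R *\<^sub>v ((A + B * K1) *\<^sub>v v)) < 0"
    using hurwitz_lyapunov[OF M hur] by blast
  obtain L W where L: "L \<in> carrier_mat q n" and W: "pos_def_mat q W"
    "\<And>v. v \<in> carrier_vec q \<Longrightarrow> v \<noteq> 0\<^sub>v q \<Longrightarrow> v \<bullet> (W *\<^sub>v ((S + L * E) *\<^sub>v v)) < 0"
    using detectable_block_observer_gain[OF A C E S det] by blast
  \<comment> \<open>On the manifold \<open>x = X1 d + X2 r\<close> with exact estimates these gains
    make the input equal to \<open>U1 d + U2 r\<close>, the feedforward for which the regulator
    equations give zero tracking error.\<close>
  define K2 where "K2 = U1 - K1 * X1"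
  define K3 where "K3 = U2 - K1 * X2"
  have K2: "K2 \<in> carrier_mat m q" and K3: "K3 \<in> carrier_mat m n\<^sub>0"
    using K1 X1 X2 U1 U2 unfolding K2_def K3_def by (auto intro!: minus_carrier_mat)
  have "tends_to_zero l (\<lambda>t. C *\<^sub>v x t + D *\<^sub>v u t - F *\<^sub>v r t)"
    if r: "solves_ode ts n\<^sub>0 r (\<lambda>t. S\<^sub>0 *\<^sub>v r t)"
      and x: "solves_ode ts n x (\<lambda>t. A *\<^sub>v x t + B *\<^sub>v u t + E *\<^sub>v d t)"
      and d: "solves_ode ts q d (\<lambda>t. S *\<^sub>v d t)"
      and \<zeta>: "solves_ode ts q \<zeta> (\<lambda>t. (S + L * E) *\<^sub>v \<zeta> t + (L * A - S * L - L * E * L) *\<^sub>v x t + (L * B) *\<^sub>v u t)"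
      and u: "\<And>t. t \<ge> 0 \<Longrightarrow> u t = K1 *\<^sub>v x t + K2 *\<^sub>v (\<zeta> t - L *\<^sub>v x t) + K3 *\<^sub>v \<eta> t"
      and \<eta>c: "\<And>t. t \<ge> 0 \<Longrightarrow> \<eta> t \<in> carrier_vec n\<^sub>0"
      and \<eta>: "tends_to_zero n\<^sub>0 (\<lambda>t. \<eta> t - r t)" for x u d \<zeta> \<eta> r
  proof -
    note rc = solves_ode_carrier[OF r] and xc = solves_ode_carrier[OF x]
      and dc = solves_ode_carrier[OF d] and \<zeta>c = solves_ode_carrier[OF \<zeta>]
    have uc: "u t \<in> carrier_vec m" if "t \<ge> 0" for t
      using u[OF that] K1 K2 K3 L xc[OF that] \<zeta>c[OF that] \<eta>c[OF that] by simp
    define \<delta> where "\<delta> t = \<zeta> t - L *\<^sub>v x t - d t" for t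
    have \<delta>c: "\<delta> t \<in> carrier_vec q" if "t \<ge> 0" for t
      using L xc[OF that] dc[OF that] \<zeta>c[OF that] by (simp add: \<delta>_def)
    \<comment> \<open>The coefficients of \<open>x\<close> and \<open>u\<close> in the observer
      cancel the known part of the derivative of \<open>L x\<close>. What is left is
      \<open>(S + L E)\<close> applied to \<open>\<zeta>\<close>, \<open>- L x\<close> and
      \<open>- d\<close>. The added zero vector is the input slot of the perturbed system.\<close>
    have \<delta>sol: "solves_ode ts q \<delta> (\<lambda>t. (S + L * E) *\<^sub>v \<delta> t + 0\<^sub>v q)"
    proof -
      have x'c: "A *\<^sub>v x t + B *\<^sub>v u t + E *\<^sub>v d t \<in> carrier_vec n" if "t \<ge> 0" for t
        using A B E xc[OF that] uc[OF that] dc[OF that] by simp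
      have "solves_ode ts q (\<lambda>t. L *\<^sub>v x t) (\<lambda>t. L *\<^sub>v (A *\<^sub>v x t + B *\<^sub>v u t + E *\<^sub>v d t))"
        by (rule solves_ode_mult_mat_vec[OF sw x x'c L])
      then have "solves_ode ts q (\<lambda>t. \<zeta> t - L *\<^sub>v x t)
          (\<lambda>t. ((S + L * E) *\<^sub>v \<zeta> t + (L * A - S * L - L * E * L) *\<^sub>v x t + (L * B) *\<^sub>v u t)
            - L *\<^sub>v (A *\<^sub>v x t + B *\<^sub>v u t + E *\<^sub>v d t))"
        using L x'c by (intro solves_ode_minus[OF sw \<zeta>]) auto
      then have "solves_ode ts q \<delta>
          (\<lambda>t. (((S + L * E) *\<^sub>v \<zeta> t + (L * A - S * L - L * E * L) *\<^sub>v x t + (L * B) *\<^sub>v u t)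
            - L *\<^sub>v (A *\<^sub>v x t + B *\<^sub>v u t + E *\<^sub>v d t)) - S *\<^sub>v d t)"
        unfolding \<delta>_def using S dc by (intro solves_ode_minus[OF sw _ d]) auto
      then show ?thesis
      proof (rule solves_ode_cong[OF sw])
        fix t :: real assume t: "t \<ge> 0"
        note c = xc[OF t] uc[OF t] dc[OF t] \<zeta>c[OF t]
        have SLE: "(S + L * E) *\<^sub>v v = S *\<^sub>v v + L *\<^sub>v (E *\<^sub>v v)" if "v \<in> carrier_vec q" for v
          using add_mult_distrib_mat_vec[OF S _ that, of "L * E"] assoc_mult_mat_vec[OF L E that] L E by simp
        have 1: "(L * A - S * L - L * E * L) *\<^sub>v x t
            = L *\<^sub>v (A *\<^sub>v x t) - S *\<^sub>v (L *\<^sub>v x t) - L *\<^sub>v (E *\<^sub>v (L *\<^sub>v x t))"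
        proof -
          have "(L * A - S * L - L * E * L) *\<^sub>v x t = (L * A - S * L) *\<^sub>v x t - (L * E * L) *\<^sub>v x t"
            using L A S E c by (intro minus_mult_distrib_mat_vec) (auto intro: minus_carrier_mat)
          also have "(L * A - S * L) *\<^sub>v x t = (L * A) *\<^sub>v x t - (S * L) *\<^sub>v x t"
            using L A S c by (intro minus_mult_distrib_mat_vec) auto
          also have "(L * E * L) *\<^sub>v x t = (L * E) *\<^sub>v (L *\<^sub>v x t)"
            using L E c by (intro assoc_mult_mat_vec) auto
          also have "(L * E) *\<^sub>v (L *\<^sub>v x t) = L *\<^sub>v (E *\<^sub>v (L *\<^sub>v x t))"
            using L E c by (intro assoc_mult_mat_vec) auto
          finally show ?thesis
            using assoc_mult_mat_vec[OF L A c(1)] assoc_mult_mat_vec[OF S L c(1)] by simp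
        qed
        have 2: "L *\<^sub>v (A *\<^sub>v x t + B *\<^sub>v u t + E *\<^sub>v d t)
            = L *\<^sub>v (A *\<^sub>v x t) + L *\<^sub>v (B *\<^sub>v u t) + L *\<^sub>v (E *\<^sub>v d t)"
          using L A B E c by (simp add: mult_add_distrib_mat_vec[of _ q n])
        have 3: "(L * B) *\<^sub>v u t = L *\<^sub>v (B *\<^sub>v u t)" by (rule assoc_mult_mat_vec[OF L B c(2)])
        have 4: "S *\<^sub>v \<delta> t = S *\<^sub>v \<zeta> t - S *\<^sub>v (L *\<^sub>v x t) - S *\<^sub>v d t"
          unfolding \<delta>_def using S L c by (simp add: mult_minus_distrib_mat_vec[of _ q q])
        have 5: "L *\<^sub>v (E *\<^sub>v \<delta> t) = L *\<^sub>v (E *\<^sub>v \<zeta> t) - L *\<^sub>v (E *\<^sub>v (L *\<^sub>v x t)) - L *\<^sub>v (E *\<^sub>v d t)"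
          unfolding \<delta>_def using E L c
          by (simp add: mult_minus_distrib_mat_vec[of _ n q] mult_minus_distrib_mat_vec[of _ q n])
        \<comment> \<open>With all products distributed, each component is an identity of linear
          arithmetic; keeping \<open>index_mult_mat_vec\<close> out of the simplifier leaves the
          products as atoms.\<close>
        show "(((S + L * E) *\<^sub>v \<zeta> t + (L * A - S * L - L * E * L) *\<^sub>v x t + (L * B) *\<^sub>v u t)
            - L *\<^sub>v (A *\<^sub>v x t + B *\<^sub>v u t + E *\<^sub>v d t)) - S *\<^sub>v d t = (S + L * E) *\<^sub>v \<delta> t + 0\<^sub>v q"
          unfolding SLE[OF c(4)] SLE[OF \<delta>c[OF t]] 1 2 3 4 5 using S L
          by (intro eq_vecI) (auto simp del: index_mult_mat_vec)
      qed
    qed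
    have SLEc: "S + L * E \<in> carrier_mat q q" using S L E by simp
    have \<delta>0: "tends_to_zero q \<delta>"
      by (rule perturbed_lyapunov_tends_to_zero[OF sw SLEc W \<delta>sol]) (auto simp: tends_to_zero_def)
    define \<epsilon> where "\<epsilon> t = \<eta> t - r t" for t
    have \<epsilon>c: "\<epsilon> t \<in> carrier_vec n\<^sub>0" if "t \<ge> 0" for t using \<eta>c[OF that] rc[OF that] by (simp add: \<epsilon>_def)
    \<comment> \<open>The combined effect of both estimation errors on the input.\<close>
    define h where "h t = K2 *\<^sub>v \<delta> t + K3 *\<^sub>v \<epsilon> t" for t
    have hc: "h t \<in> carrier_vec m" if "t \<ge> 0" for t using K2 K3 \<delta>c[OF that] \<epsilon>c[OF that] by (simp add: h_def)
    have h0: "tends_to_zero m h"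
      unfolding h_def
    proof (rule tends_to_zero_add)
      show "tends_to_zero m (\<lambda>t. K2 *\<^sub>v \<delta> t)" by (rule tends_to_zero_mult_mat_vec[OF \<delta>0 \<delta>c K2])
      show "tends_to_zero m (\<lambda>t. K3 *\<^sub>v \<epsilon> t)"
        using \<eta> \<epsilon>c K3 by (intro tends_to_zero_mult_mat_vec) (auto simp: \<epsilon>_def)
    qed (use K3 \<epsilon>c in auto)
    define \<xi> where "\<xi> t = x t - X1 *\<^sub>v d t - X2 *\<^sub>v r t" for t
    have \<xi>c: "\<xi> t \<in> carrier_vec n" if "t \<ge> 0" for t
      using X1 X2 xc[OF that] dc[OF that] rc[OF that] by (simp add: \<xi>_def)
    have distrib: "G *\<^sub>v x t = G *\<^sub>v \<xi> t + G *\<^sub>v (X1 *\<^sub>v d t) + G *\<^sub>v (X2 *\<^sub>v r t)"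
      if "G \<in> carrier_mat k n" "t \<ge> 0" for G k t
    proof -
      have "x t = \<xi> t + X1 *\<^sub>v d t + X2 *\<^sub>v r t"
        unfolding \<xi>_def using X1 X2 xc[OF that(2)] by (intro eq_vecI) (auto simp del: index_mult_mat_vec)
      then have "G *\<^sub>v x t = G *\<^sub>v (\<xi> t + X1 *\<^sub>v d t + X2 *\<^sub>v r t)" by simp
      also have "\<dots> = G *\<^sub>v \<xi> t + G *\<^sub>v (X1 *\<^sub>v d t) + G *\<^sub>v (X2 *\<^sub>v r t)"
        using that(1) X1 X2 \<xi>c[OF that(2)] dc[OF that(2)] rc[OF that(2)]
        by (simp add: mult_add_distrib_mat_vec[of _ k n] assoc_add_vec[of _ k])
      finally show ?thesis .
    qed
    \<comment> \<open>The \<open>K1\<close> terms in \<open>X1 d\<close> and \<open>X2 r\<close>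
      cancel against the corrections in \<open>K2\<close> and \<open>K3\<close>, so that the
      feedforward appears unspoiled.\<close>
    have u_eq: "u t = K1 *\<^sub>v \<xi> t + U1 *\<^sub>v d t + U2 *\<^sub>v r t + h t" if t: "t \<ge> 0" for t
    proof -
      note c = xc[OF t] dc[OF t] rc[OF t] \<zeta>c[OF t] \<eta>c[OF t] \<delta>c[OF t] \<epsilon>c[OF t]
      have "\<zeta> t - L *\<^sub>v x t = \<delta> t + d t"
        unfolding \<delta>_def using L c by (intro eq_vecI) (auto simp del: index_mult_mat_vec)
      then have 1: "K2 *\<^sub>v (\<zeta> t - L *\<^sub>v x t) = K2 *\<^sub>v \<delta> t + K2 *\<^sub>v d t"
        using K2 c by (simp add: mult_add_distrib_mat_vec[of _ m q])
      have "\<eta> t = \<epsilon> t + r t" unfolding \<epsilon>_def using c by (intro eq_vecI) auto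
      then have 2: "K3 *\<^sub>v \<eta> t = K3 *\<^sub>v \<epsilon> t + K3 *\<^sub>v r t"
        using K3 c by (simp add: mult_add_distrib_mat_vec[of _ m n\<^sub>0])
      have 3: "K2 *\<^sub>v d t = U1 *\<^sub>v d t - K1 *\<^sub>v (X1 *\<^sub>v d t)"
        unfolding K2_def using minus_mult_distrib_mat_vec[OF U1 _ c(2), of "K1 * X1"] K1 X1 U1
          assoc_mult_mat_vec[OF K1 X1 c(2)] by simp
      have 4: "K3 *\<^sub>v r t = U2 *\<^sub>v r t - K1 *\<^sub>v (X2 *\<^sub>v r t)"
        unfolding K3_def using minus_mult_distrib_mat_vec[OF U2 _ c(3), of "K1 * X2"] K1 X2 U2
          assoc_mult_mat_vec[OF K1 X2 c(3)] by simp
      show ?thesis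
        unfolding u[OF t] h_def 1 2 3 4 distrib[OF K1 t] using K1 K2 K3 U1 U2
        by (intro eq_vecI) (auto simp del: index_mult_mat_vec)
    qed
    have u_distrib: "G *\<^sub>v u t = G *\<^sub>v (K1 *\<^sub>v \<xi> t) + G *\<^sub>v (U1 *\<^sub>v d t) + G *\<^sub>v (U2 *\<^sub>v r t) + G *\<^sub>v h t"
      if "G \<in> carrier_mat k m" "t \<ge> 0" for G k t
      unfolding u_eq[OF that(2)]
      using that(1) K1 U1 U2 \<xi>c[OF that(2)] dc[OF that(2)] rc[OF that(2)] hc[OF that(2)]
      by (simp add: mult_add_distrib_mat_vec[of _ k m] assoc_add_vec[of _ k])
    \<comment> \<open>The differential regulator equations cancel every occurrence of
      \<open>d\<close> and \<open>r\<close>, including the disturbance term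
      \<open>E d\<close>.\<close>
    have \<xi>sol: "solves_ode ts n \<xi> (\<lambda>t. (A + B * K1) *\<^sub>v \<xi> t + B *\<^sub>v h t)"
    proof -
      have dX: "solves_ode ts n (\<lambda>t. X1 *\<^sub>v d t) (\<lambda>t. X1 *\<^sub>v (S *\<^sub>v d t))"
        using S dc by (intro solves_ode_mult_mat_vec[OF sw d _ X1]) auto
      have rX: "solves_ode ts n (\<lambda>t. X2 *\<^sub>v r t) (\<lambda>t. X2 *\<^sub>v (S\<^sub>0 *\<^sub>v r t))"
        using S\<^sub>0 rc by (intro solves_ode_mult_mat_vec[OF sw r _ X2]) auto
      have "solves_ode ts n (\<lambda>t. x t - X1 *\<^sub>v d t)
          (\<lambda>t. (A *\<^sub>v x t + B *\<^sub>v u t + E *\<^sub>v d t) - X1 *\<^sub>v (S *\<^sub>v d t))"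
        using X1 S dc by (intro solves_ode_minus[OF sw x dX]) auto
      then have "solves_ode ts n \<xi>
          (\<lambda>t. ((A *\<^sub>v x t + B *\<^sub>v u t + E *\<^sub>v d t) - X1 *\<^sub>v (S *\<^sub>v d t)) - X2 *\<^sub>v (S\<^sub>0 *\<^sub>v r t))"
        unfolding \<xi>_def using X2 S\<^sub>0 rc by (intro solves_ode_minus[OF sw _ rX]) auto
      then show ?thesis
      proof (rule solves_ode_cong[OF sw])
        fix t :: real assume t: "t \<ge> 0"
        note c = xc[OF t] dc[OF t] rc[OF t] \<xi>c[OF t] hc[OF t]
        have 1: "X1 *\<^sub>v (S *\<^sub>v d t) = A *\<^sub>v (X1 *\<^sub>v d t) + B *\<^sub>v (U1 *\<^sub>v d t) + E *\<^sub>v d t"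
        proof -
          have "X1 *\<^sub>v (S *\<^sub>v d t) = (A * X1 + B * U1 + E) *\<^sub>v d t"
            using assoc_mult_mat_vec[OF X1 S c(2)] reg1(1) by simp
          also have "\<dots> = (A * X1 + B * U1) *\<^sub>v d t + E *\<^sub>v d t"
            using A X1 B U1 E c by (intro add_mult_distrib_mat_vec) auto
          also have "(A * X1 + B * U1) *\<^sub>v d t = (A * X1) *\<^sub>v d t + (B * U1) *\<^sub>v d t"
            using A X1 B U1 c by (intro add_mult_distrib_mat_vec) auto
          finally show ?thesis
            using assoc_mult_mat_vec[OF A X1 c(2)] assoc_mult_mat_vec[OF B U1 c(2)] by simp
        qed
        have 2: "X2 *\<^sub>v (S\<^sub>0 *\<^sub>v r t) = A *\<^sub>v (X2 *\<^sub>v r t) + B *\<^sub>v (U2 *\<^sub>v r t)"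
        proof -
          have "X2 *\<^sub>v (S\<^sub>0 *\<^sub>v r t) = (A * X2 + B * U2) *\<^sub>v r t"
            using assoc_mult_mat_vec[OF X2 S\<^sub>0 c(3)] reg2(1) by simp
          also have "\<dots> = (A * X2) *\<^sub>v r t + (B * U2) *\<^sub>v r t"
            using A X2 B U2 c by (intro add_mult_distrib_mat_vec) auto
          finally show ?thesis
            using assoc_mult_mat_vec[OF A X2 c(3)] assoc_mult_mat_vec[OF B U2 c(3)] by simp
        qed
        have 3: "(A + B * K1) *\<^sub>v \<xi> t = A *\<^sub>v \<xi> t + B *\<^sub>v (K1 *\<^sub>v \<xi> t)"
          using add_mult_distrib_mat_vec[OF A _ c(4), of "B * K1"] assoc_mult_mat_vec[OF B K1 c(4)] B K1 by simp
        show "((A *\<^sub>v x t + B *\<^sub>v u t + E *\<^sub>v d t) - X1 *\<^sub>v (S *\<^sub>v d t)) - X2 *\<^sub>v (S\<^sub>0 *\<^sub>v r t)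
            = (A + B * K1) *\<^sub>v \<xi> t + B *\<^sub>v h t"
          unfolding 1 2 3 distrib[OF A t] u_distrib[OF B t] using A B E
          by (intro eq_vecI) (auto simp del: index_mult_mat_vec)
      qed
    qed
    have \<xi>0: "tends_to_zero n \<xi>"
    proof (rule perturbed_lyapunov_tends_to_zero[OF sw M R \<xi>sol])
      show "tends_to_zero n (\<lambda>t. B *\<^sub>v h t)" by (rule tends_to_zero_mult_mat_vec[OF h0 hc B])
    qed (use B hc in auto)
    \<comment> \<open>This is the tracking error after the two algebraic regulator equations have
      removed \<open>d\<close> and \<open>r\<close> from the output.\<close>
    have "tends_to_zero l (\<lambda>t. C *\<^sub>v \<xi> t + D *\<^sub>v (K1 *\<^sub>v \<xi> t) + D *\<^sub>v h t)"
    proof (intro tends_to_zero_add)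
      show "tends_to_zero l (\<lambda>t. C *\<^sub>v \<xi> t)" by (rule tends_to_zero_mult_mat_vec[OF \<xi>0 \<xi>c C])
      have "tends_to_zero m (\<lambda>t. K1 *\<^sub>v \<xi> t)" by (rule tends_to_zero_mult_mat_vec[OF \<xi>0 \<xi>c K1])
      then show "tends_to_zero l (\<lambda>t. D *\<^sub>v (K1 *\<^sub>v \<xi> t))"
        by (rule tends_to_zero_mult_mat_vec[OF _ _ D]) (use K1 \<xi>c in auto)
      show "tends_to_zero l (\<lambda>t. D *\<^sub>v h t)" by (rule tends_to_zero_mult_mat_vec[OF h0 hc D])
    qed (use D K1 hc \<xi>c in auto)
    then show ?thesis
    proof (rule tends_to_zero_cong)
      fix t :: real assume t: "t \<ge> 0"
      note c = dc[OF t] rc[OF t]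
      have 1: "C *\<^sub>v (X1 *\<^sub>v d t) + D *\<^sub>v (U1 *\<^sub>v d t) = 0\<^sub>v l"
      proof -
        have z: "0\<^sub>m l q *\<^sub>v d t = 0\<^sub>v l" using c by (intro eq_vecI) auto
        have "(C * X1 + D * U1) *\<^sub>v d t = (C * X1) *\<^sub>v d t + (D * U1) *\<^sub>v d t"
          using C X1 D U1 c by (intro add_mult_distrib_mat_vec) auto
        then show ?thesis
          using assoc_mult_mat_vec[OF C X1 c(1)] assoc_mult_mat_vec[OF D U1 c(1)] z
          by (simp add: reg1(2)[symmetric])
      qed
      have 2: "C *\<^sub>v (X2 *\<^sub>v r t) + D *\<^sub>v (U2 *\<^sub>v r t) - F *\<^sub>v r t = 0\<^sub>v l"
      proof -
        have z: "0\<^sub>m l n\<^sub>0 *\<^sub>v r t = 0\<^sub>v l" using c by (intro eq_vecI) auto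
        have "(C * X2 + D * U2 - F) *\<^sub>v r t = (C * X2 + D * U2) *\<^sub>v r t - F *\<^sub>v r t"
          using C X2 D U2 F c by (intro minus_mult_distrib_mat_vec) auto
        also have "(C * X2 + D * U2) *\<^sub>v r t = (C * X2) *\<^sub>v r t + (D * U2) *\<^sub>v r t"
          using C X2 D U2 c by (intro add_mult_distrib_mat_vec) auto
        finally show ?thesis
          using assoc_mult_mat_vec[OF C X2 c(2)] assoc_mult_mat_vec[OF D U2 c(2)] z
          by (simp add: reg2(2)[symmetric])
      qed
      show "C *\<^sub>v \<xi> t + D *\<^sub>v (K1 *\<^sub>v \<xi> t) + D *\<^sub>v h t = C *\<^sub>v x t + D *\<^sub>v u t - F *\<^sub>v r t"
      proof (rule eq_vecI)
        fix k assume "k < dim_vec (C *\<^sub>v x t + D *\<^sub>v u t - F *\<^sub>v r t)"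
        then have k: "k < l" using F by simp
        have "(C *\<^sub>v (X1 *\<^sub>v d t) + D *\<^sub>v (U1 *\<^sub>v d t)) $ k = 0"
          "(C *\<^sub>v (X2 *\<^sub>v r t) + D *\<^sub>v (U2 *\<^sub>v r t) - F *\<^sub>v r t) $ k = 0"
          unfolding 1 2 using k by simp_all
        then show "(C *\<^sub>v \<xi> t + D *\<^sub>v (K1 *\<^sub>v \<xi> t) + D *\<^sub>v h t) $ k = (C *\<^sub>v x t + D *\<^sub>v u t - F *\<^sub>v r t) $ k"
          unfolding distrib[OF C t] u_distrib[OF D t] using C D F k
          by (simp del: index_mult_mat_vec)
      qed (use C D F in auto)
    qed
  qed
  with K1 K2 K3 L show ?thesis by (rule that)
qed

theorem theorem2:
  fixes N \<kappa> l :: nat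
    and n m q :: "nat \<Rightarrow> nat"
    and A B C D E S :: "nat \<Rightarrow> real mat"
    and F\<^sub>0 P L\<^sub>0 :: "real mat"
    and a :: "nat \<Rightarrow> nat \<Rightarrow> nat \<Rightarrow> real"
    and \<sigma> :: "real \<Rightarrow> nat"
    and ts :: "nat \<Rightarrow> real"
    and \<tau>\<^sub>0 :: real
  assumes N: "N \<ge> 1"
    and dims: "\<And>i. i \<in> {1..N} \<Longrightarrow>
        A i \<in> carrier_mat (n i) (n i) \<and> B i \<in> carrier_mat (n i) (m i) \<and>
        C i \<in> carrier_mat l (n i) \<and> D i \<in> carrier_mat l (m i) \<and>
        E i \<in> carrier_mat (n i) (q i) \<and> S i \<in> carrier_mat (q i) (q i)"
    and leader_dims: "S 0 \<in> carrier_mat (n 0) (n 0)" "F\<^sub>0 \<in> carrier_mat l (n 0)"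
    and leader_detectable: "detectable F\<^sub>0 (S 0)"
    and exo: "\<And>i. i \<in> {0..N} \<Longrightarrow> no_open_left_half_plane_eigenvalue (S i)"
    and stab: "\<And>i. i \<in> {1..N} \<Longrightarrow> stabilizable (A i) (B i)"
    and graphs: "\<And>p. p \<in> {1..\<kappa>} \<Longrightarrow> leader_digraph N (a p)"
    and switching: "switching_signal \<kappa> \<tau>\<^sub>0 ts \<sigma>"
    and connected_graphs: "\<And>p. p \<in> {1..\<kappa>} \<Longrightarrow> leader_connected N (a p)"
    and regulator: "\<And>i. i \<in> {1..N} \<Longrightarrow>
        \<exists>X1 \<in> carrier_mat (n i) (q i). \<exists>X2 \<in> carrier_mat (n i) (n 0).
        \<exists>U1 \<in> carrier_mat (m i) (q i). \<exists>U2 \<in> carrier_mat (m i) (n 0).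
          X1 * S i = A i * X1 + B i * U1 + E i \<and>
          0\<^sub>m l (q i) = C i * X1 + D i * U1 \<and>
          X2 * S 0 = A i * X2 + B i * U2 \<and>
          0\<^sub>m l (n 0) = C i * X2 + D i * U2 - F\<^sub>0"
    and follower_detectable: "\<And>i. i \<in> {1..N} \<Longrightarrow>
        detectable (block_row (C i) (0\<^sub>m l (q i)))
          (four_block_mat (A i) (E i) (0\<^sub>m (q i) (n i)) (S i))"
    and P: "pos_def_mat (n 0) P"
    and P_ineq: "neg_def_mat (n 0)
        (P * S 0 + transpose_mat (S 0) * P - 2 \<cdot>\<^sub>m (transpose_mat F\<^sub>0 * F\<^sub>0))"
    and L\<^sub>0: "L\<^sub>0 = (- mu_star N \<kappa> a) \<cdot>\<^sub>m (the (mat_inverse P) * transpose_mat F\<^sub>0)"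
  shows "\<exists>K1 K2 K3 L :: nat \<Rightarrow> real mat.
    (\<forall>i\<in>{1..N}.
        K1 i \<in> carrier_mat (m i) (n i) \<and> K2 i \<in> carrier_mat (m i) (q i) \<and>
        K3 i \<in> carrier_mat (m i) (n 0) \<and> L i \<in> carrier_mat (q i) (n i)) \<and>
    (\<forall>(x :: nat \<Rightarrow> real \<Rightarrow> real vec) u d y \<zeta> \<eta> (r :: real \<Rightarrow> real vec).
        solves_ode ts (n 0) r (\<lambda>t. S 0 *\<^sub>v r t) \<and>
        (\<forall>t\<ge>0. y 0 t = F\<^sub>0 *\<^sub>v r t) \<and>
        (\<forall>t\<ge>0. \<eta> 0 t = r t) \<and>
        (\<forall>i\<in>{1..N}.
            solves_ode ts (n i) (x i)
              (\<lambda>t. A i *\<^sub>v x i t + B i *\<^sub>v u i t + E i *\<^sub>v d i t) \<and>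
            (\<forall>t\<ge>0. y i t = C i *\<^sub>v x i t + D i *\<^sub>v u i t) \<and>
            solves_ode ts (q i) (d i) (\<lambda>t. S i *\<^sub>v d i t) \<and>
            solves_ode ts (q i) (\<zeta> i)
              (\<lambda>t. (S i + L i * E i) *\<^sub>v \<zeta> i t
                  + (L i * A i - S i * L i - L i * E i * L i) *\<^sub>v x i t
                  + (L i * B i) *\<^sub>v u i t) \<and>
            solves_ode ts (n 0) (\<eta> i)
              (\<lambda>t. S 0 *\<^sub>v \<eta> i t
                  + (L\<^sub>0 * F\<^sub>0) *\<^sub>v relative_sum (n 0) N (a (\<sigma> t)) (\<lambda>j. \<eta> j t) i) \<and>
            (\<forall>t\<ge>0. u i t = K1 i *\<^sub>v x i t
                  + K2 i *\<^sub>v (\<zeta> i t - L i *\<^sub>v x i t) + K3 i *\<^sub>v \<eta> i t))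
        \<longrightarrow> (\<forall>i\<in>{1..N}. tends_to_zero l (\<lambda>t. y i t - y 0 t)))"
proof -
  \<comment> \<open>A property of a single follower, universally quantified over trajectories, so
    that the gains can be chosen index by index and independently of the trajectory.\<close>
  define good where "good i K1 K2 K3 L \<longleftrightarrow>
      K1 \<in> carrier_mat (m i) (n i) \<and> K2 \<in> carrier_mat (m i) (q i) \<and>
      K3 \<in> carrier_mat (m i) (n 0) \<and> L \<in> carrier_mat (q i) (n i) \<and>
      (\<forall>x u d \<zeta> \<eta> r.
        solves_ode ts (n 0) r (\<lambda>t. S 0 *\<^sub>v r t) \<longrightarrow>
        solves_ode ts (n i) x (\<lambda>t. A i *\<^sub>v x t + B i *\<^sub>v u t + E i *\<^sub>v d t) \<longrightarrow>
        solves_ode ts (q i) d (\<lambda>t. S i *\<^sub>v d t) \<longrightarrow>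
        solves_ode ts (q i) \<zeta> (\<lambda>t. (S i + L * E i) *\<^sub>v \<zeta> t
          + (L * A i - S i * L - L * E i * L) *\<^sub>v x t + (L * B i) *\<^sub>v u t) \<longrightarrow>
        (\<forall>t\<ge>0. u t = K1 *\<^sub>v x t + K2 *\<^sub>v (\<zeta> t - L *\<^sub>v x t) + K3 *\<^sub>v \<eta> t) \<longrightarrow>
        (\<forall>t\<ge>0. \<eta> t \<in> carrier_vec (n 0)) \<longrightarrow>
        tends_to_zero (n 0) (\<lambda>t. \<eta> t - r t) \<longrightarrow>
        tends_to_zero l (\<lambda>t. C i *\<^sub>v x t + D i *\<^sub>v u t - F\<^sub>0 *\<^sub>v r t))"
    for i and K1 K2 K3 L :: "real mat"
  have "\<exists>K1 K2 K3 L. good i K1 K2 K3 L" if i: "i \<in> {1..N}" for i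
  proof -
    obtain X1 X2 U1 U2 where "X1 \<in> carrier_mat (n i) (q i)" "X2 \<in> carrier_mat (n i) (n 0)"
      "U1 \<in> carrier_mat (m i) (q i)" "U2 \<in> carrier_mat (m i) (n 0)"
      "X1 * S i = A i * X1 + B i * U1 + E i" "0\<^sub>m l (q i) = C i * X1 + D i * U1"
      "X2 * S 0 = A i * X2 + B i * U2" "0\<^sub>m l (n 0) = C i * X2 + D i * U2 - F\<^sub>0"
      using regulator[OF i] by blast
    note X = this
    have "A i \<in> carrier_mat (n i) (n i)" "B i \<in> carrier_mat (n i) (m i)" "C i \<in> carrier_mat l (n i)"
      "D i \<in> carrier_mat l (m i)" "E i \<in> carrier_mat (n i) (q i)" "S i \<in> carrier_mat (q i) (q i)"
      using dims[OF i] by auto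
    from this leader_dims stab[OF i] follower_detectable[OF i] X switching
    show ?thesis
    proof (rule follower_gains)
      fix K1 K2 K3 L
      assume "K1 \<in> carrier_mat (m i) (n i)" "K2 \<in> carrier_mat (m i) (q i)"
      "K3 \<in> carrier_mat (m i) (n 0)" "L \<in> carrier_mat (q i) (n i)"
      and "\<And>x u d \<zeta> \<eta> r.
        solves_ode ts (n 0) r (\<lambda>t. S 0 *\<^sub>v r t) \<Longrightarrow>
        solves_ode ts (n i) x (\<lambda>t. A i *\<^sub>v x t + B i *\<^sub>v u t + E i *\<^sub>v d t) \<Longrightarrow>
        solves_ode ts (q i) d (\<lambda>t. S i *\<^sub>v d t) \<Longrightarrow>
        solves_ode ts (q i) \<zeta> (\<lambda>t. (S i + L * E i) *\<^sub>v \<zeta> t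
          + (L * A i - S i * L - L * E i * L) *\<^sub>v x t + (L * B i) *\<^sub>v u t) \<Longrightarrow>
        (\<And>t. t \<ge> 0 \<Longrightarrow> u t = K1 *\<^sub>v x t + K2 *\<^sub>v (\<zeta> t - L *\<^sub>v x t) + K3 *\<^sub>v \<eta> t) \<Longrightarrow>
        (\<And>t. t \<ge> 0 \<Longrightarrow> \<eta> t \<in> carrier_vec (n 0)) \<Longrightarrow>
        tends_to_zero (n 0) (\<lambda>t. \<eta> t - r t) \<Longrightarrow>
        tends_to_zero l (\<lambda>t. C i *\<^sub>v x t + D i *\<^sub>v u t - F\<^sub>0 *\<^sub>v r t)"
      then have "good i K1 K2 K3 L" unfolding good_def by simp
      then show ?thesis by blast
    qed
  qed
  then obtain K1 K2 K3 L where K: "\<And>i. i \<in> {1..N} \<Longrightarrow> good i (K1 i) (K2 i) (K3 i) (L i)" by metis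
  show ?thesis
  proof (rule exI[of _ K1], rule exI[of _ K2], rule exI[of _ K3], rule exI[of _ L],
      intro conjI allI impI ballI; (elim conjE)?)
    fix x u d y \<zeta> \<eta> and r :: "real \<Rightarrow> real vec" and i
    assume r: "solves_ode ts (n 0) r (\<lambda>t. S 0 *\<^sub>v r t)" and y0: "\<forall>t\<ge>0. y 0 t = F\<^sub>0 *\<^sub>v r t"
      and \<eta>0: "\<forall>t\<ge>0. \<eta> 0 t = r t" and i: "i \<in> {1..N}"
      and loop: "\<forall>i\<in>{1..N}.
            solves_ode ts (n i) (x i)
              (\<lambda>t. A i *\<^sub>v x i t + B i *\<^sub>v u i t + E i *\<^sub>v d i t) \<and>
            (\<forall>t\<ge>0. y i t = C i *\<^sub>v x i t + D i *\<^sub>v u i t) \<and>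
            solves_ode ts (q i) (d i) (\<lambda>t. S i *\<^sub>v d i t) \<and>
            solves_ode ts (q i) (\<zeta> i)
              (\<lambda>t. (S i + L i * E i) *\<^sub>v \<zeta> i t
                  + (L i * A i - S i * L i - L i * E i * L i) *\<^sub>v x i t
                  + (L i * B i) *\<^sub>v u i t) \<and>
            solves_ode ts (n 0) (\<eta> i)
              (\<lambda>t. S 0 *\<^sub>v \<eta> i t
                  + (L\<^sub>0 * F\<^sub>0) *\<^sub>v relative_sum (n 0) N (a (\<sigma> t)) (\<lambda>j. \<eta> j t) i) \<and>
            (\<forall>t\<ge>0. u i t = K1 i *\<^sub>v x i t
                  + K2 i *\<^sub>v (\<zeta> i t - L i *\<^sub>v x i t) + K3 i *\<^sub>v \<eta> i t)"
    have \<eta>: "solves_ode ts (n 0) (\<eta> j) (\<lambda>t. S 0 *\<^sub>v \<eta> j t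
        + (L\<^sub>0 * F\<^sub>0) *\<^sub>v relative_sum (n 0) N (a (\<sigma> t)) (\<lambda>k. \<eta> k t) j)" if "j \<in> {1..N}" for j
      using loop that by blast
    have "\<eta> 0 t = r t" if "t \<ge> 0" for t using \<eta>0 that by blast
    \<comment> \<open>The dynamics of \<open>\<eta>\<close> involve neither the follower states nor
      the chosen gains, so this convergence holds along every closed-loop trajectory and discharges
      the last premise of \<open>good\<close>.\<close>
    note conv = leader_observer_converges[OF N switching graphs connected_graphs leader_dims P P_ineq L\<^sub>0 r this \<eta> i]
    have "tends_to_zero l (\<lambda>t. C i *\<^sub>v x i t + D i *\<^sub>v u i t - F\<^sub>0 *\<^sub>v r t)"
      using K[OF i] r loop[rule_format, OF i] conv solves_ode_carrier[OF \<eta>[OF i]]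
      unfolding good_def by blast
    then show "tends_to_zero l (\<lambda>t. y i t - y 0 t)"
      by (rule tends_to_zero_cong) (use y0 loop i in auto)
  qed (use K in \<open>auto simp: good_def\<close>)
qed

end
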